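(* Let $\varphi$ be a non-degenerate computable forecasting system and let $\omega\in\Omega$. Then $\omega$ is Martin-Löf random for $\varphi$ if and only if $\omega$ is Martin-Löf test random for $\varphi$.
   Context: Notation: $\mathbb N_0=\{0,1,2,\dots\}$; $\Omega=\{0,1\}^{\mathbb N}$ is the set of paths $\omega=(\omega_1,\omega_2,\dots)$; $\mathbb S=\bigcup_{n\in\mathbb N_0}\{0,1\}^n$ is the set of situations (finite binary strings), $\square$ the empty string, $|s|$ the length of $s$, $\omega^n=(\omega_1,\dots,\omega_n)$ with $\omega^0=\square$, and $sx$ the concatenation of $s$ with $x\in\{0,1\}$. The cylinder set of $s$ is $[s]=\{\omega\in\Omega:\omega^{|s|}=s\}$ and $[A]=\bigcup_{s\in A}[s]$ for $A\subseteq\mathbb S$. For $A\subseteq\mathbb N_0\times\mathbb S$ and $n\in\mathbb N_0$, $A_n=\{s\in\mathbb S:(n,s)\in A\}$. Forecasts: $\mathcal I$ is the set of nonempty closed subintervals of $[0,1]$; for $I\in\mathcal I$ and $f:\{0,1\}\to\mathbb R$, $\overline E_I(f)=\max_{p\in I}[pf(1)+(1-p)f(0)]$. A forecasting system is a map $\varphi:\mathbb S\to\mathcal I$; write $\underline\varphi(s)=\min\varphi(s)$, $\overline\varphi(s)=\max\varphi(s)$. It is non-degenerate if $\underline\varphi(s)<1$ and $\overline\varphi(s)>0$ for all $s\in\mathbb S$. A supermartingale for $\varphi$ is a map $M:\mathbb S\to\mathbb R$ with $\overline E_{\varphi(s)}(M(s\,\cdot))\le M(s)$ for all $s$, where $M(s\,\cdot)$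 is the map $x\mapsto M(sx)$. A test supermartingale is a non-negative supermartingale with $M(\square)=1$. Global upper probability: for $G\subseteq\Omega$, $\overline P_\varphi(G)=\inf\{M(\square): M\text{ supermartingale for }\varphi,\ \liminf_{n\to\infty}M(\omega^n)\ge \mathbb 1_G(\omega)\text{ for all }\omega\in\Omega\}$. Computability: elements of countable sets such as $\mathbb N_0,\mathbb S,\mathbb Q$ and their products are encoded by natural numbers; recursive maps and recursive/recursively enumerable sets are as usual. A real map $r:\mathcal D\to\mathbb R$ is lower semicomputable if there is a recursive $q:\mathcal D\times\mathbb N_0\to\mathbb Q$ with $q(d,n+1)\ge q(d,n)$ and $\lim_n q(d,n)=r(d)$ for all $d$; upper semicomputable if $-r$ is lower semicomputable; computable if both (equivalently, there is a recursive $q:\mathcal D\times\mathbb N_0\to\mathbb Q$ with $|r(d)-q(d,N)|\le2^{-N}$ for all $d,N$). $\varphi$ is computable if $\underline\varphi$ and $\overline\varphi$ are computable real maps on $\mathbb S$. Martin-Löf randomness: $\omega$ is Martin-Löf random for $\varphi$ if every lower semicomputable test supermartingale $T$ for $\varphi$ satisfies $\sup_{n\in\mathbb N_0}T(\omega^n)<\infty$. A Martin-Löf test for $\varphi$ is a recursively enumerable set $A\subseteq\mathbb N_0\times\mathbb S$ with $\overline P_\varphi([A_n])\le2^{-n}$ for all $n\in\mathbb N_0$. $\omega$ is Martin-Löf test random for $\varphi$ if $\omega\notin\bigcap_{n\in\mathbb N_0}[A_n]$ for every Martin-Löf test $A$ for $\varphi$. *)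

theory Defs
  imports Complex_Main "HOL-Library.Nat_Bijection" "HOL-Library.Extended_Real"
    "HOL-Library.Liminf_Limsup"
begin

text \<open>A situation (finite binary string) is a bool list (True = 1, False = 0);
  a path is a map nat => bool, where omega i is the (i+1)-st outcome omega_(i+1).\<close>

type_synonym sit = "bool list"
type_synonym path = "nat \<Rightarrow> bool"

definition prefix :: "path \<Rightarrow> nat \<Rightarrow> sit" where
  "prefix \<omega> n = map \<omega> [0..<n]"

definition cyl :: "sit \<Rightarrow> path set" where
  "cyl s = {\<omega>. prefix \<omega> (length s) = s}"

definition cylset :: "sit set \<Rightarrow> path set" where
  "cylset A = (\<Union>s\<in>A. cyl s)"

definition section_at :: "(nat \<times> sit) set \<Rightarrow> nat \<Rightarrow> sit set" where
  "section_at A n = {s. (n, s) \<in> A}"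

definition intervals :: "real set set" where
  "intervals = {{a..b} | a b. 0 \<le> a \<and> a \<le> b \<and> b \<le> 1}"

definition upper_exp :: "real set \<Rightarrow> (bool \<Rightarrow> real) \<Rightarrow> real" where
  "upper_exp I f = Sup ((\<lambda>p. p * f True + (1 - p) * f False) ` I)"

definition forecasting_system :: "(sit \<Rightarrow> real set) \<Rightarrow> bool" where
  "forecasting_system \<phi> \<longleftrightarrow> (\<forall>s. \<phi> s \<in> intervals)"

definition lower_fc :: "(sit \<Rightarrow> real set) \<Rightarrow> sit \<Rightarrow> real" where
  "lower_fc \<phi> s = Inf (\<phi> s)"

definition upper_fc :: "(sit \<Rightarrow> real set) \<Rightarrow> sit \<Rightarrow> real" where
  "upper_fc \<phi> s = Sup (\<phi> s)"

definition non_degenerate :: "(sit \<Rightarrow> real set) \<Rightarrow> bool" where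
  "non_degenerate \<phi> \<longleftrightarrow> (\<forall>s. lower_fc \<phi> s < 1 \<and> upper_fc \<phi> s > 0)"

definition supermartingale :: "(sit \<Rightarrow> real set) \<Rightarrow> (sit \<Rightarrow> real) \<Rightarrow> bool" where
  "supermartingale \<phi> M \<longleftrightarrow> (\<forall>s. upper_exp (\<phi> s) (\<lambda>x. M (s @ [x])) \<le> M s)"

definition test_supermartingale :: "(sit \<Rightarrow> real set) \<Rightarrow> (sit \<Rightarrow> real) \<Rightarrow> bool" where
  "test_supermartingale \<phi> M \<longleftrightarrow>
     supermartingale \<phi> M \<and> (\<forall>s. 0 \<le> M s) \<and> M [] = 1"

definition upper_prob :: "(sit \<Rightarrow> real set) \<Rightarrow> path set \<Rightarrow> ereal" where
  "upper_prob \<phi> G = Inf {ereal (M []) | M. supermartingale \<phi> M \<and>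
       (\<forall>\<omega>. liminf (\<lambda>n. ereal (M (prefix \<omega> n))) \<ge> (if \<omega> \<in> G then 1 else 0))}"

datatype recf = Zf | Sf | Idf nat | Cnf recf "recf list" | Prf recf recf | Mnf recf

inductive eval_recf :: "recf \<Rightarrow> nat list \<Rightarrow> nat \<Rightarrow> bool" where
  zero: "eval_recf Zf xs 0"
| succ: "eval_recf Sf (x # xs) (Suc x)"
| proj: "i < length xs \<Longrightarrow> eval_recf (Idf i) xs (xs ! i)"
| comp: "list_all2 (\<lambda>g y. eval_recf g xs y) gs ys \<Longrightarrow> eval_recf f ys y
           \<Longrightarrow> eval_recf (Cnf f gs) xs y"
| pr0: "eval_recf f xs y \<Longrightarrow> eval_recf (Prf f g) (0 # xs) y"
| prS: "eval_recf (Prf f g) (n # xs) y \<Longrightarrow> eval_recf g (y # n # xs) z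
           \<Longrightarrow> eval_recf (Prf f g) (Suc n # xs) z"
| mn: "eval_recf f (n # xs) 0 \<Longrightarrow> (\<forall>m<n. \<exists>k. eval_recf f (m # xs) (Suc k))
           \<Longrightarrow> eval_recf (Mnf f) xs n"

definition recursive_fun :: "(nat \<Rightarrow> nat) \<Rightarrow> bool" where
  "recursive_fun f \<longleftrightarrow> (\<exists>r. \<forall>n. eval_recf r [n] (f n))"

definition rec_enum :: "nat set \<Rightarrow> bool" where
  "rec_enum A \<longleftrightarrow> (\<exists>r. A = {n. \<exists>y. eval_recf r [n] y})"

definition code_sit :: "sit \<Rightarrow> nat" where
  "code_sit s = list_encode (map (\<lambda>b. if b then 1 else 0) s)"

definition code_ns :: "nat \<times> sit \<Rightarrow> nat" where
  "code_ns p = prod_encode (fst p, code_sit (snd p))"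

definition recursive_rat_map :: "(sit \<Rightarrow> nat \<Rightarrow> rat) \<Rightarrow> bool" where
  "recursive_rat_map q \<longleftrightarrow> (\<exists>a b. recursive_fun a \<and> recursive_fun b \<and>
     (\<forall>s n. q s n = of_int (int_decode (a (prod_encode (code_sit s, n))))
                    / of_nat (b (prod_encode (code_sit s, n)))))"

definition lower_semicomputable :: "(sit \<Rightarrow> real) \<Rightarrow> bool" where
  "lower_semicomputable r \<longleftrightarrow> (\<exists>q. recursive_rat_map q \<and>
     (\<forall>s n. q s n \<le> q s (Suc n)) \<and>
     (\<forall>s. (\<lambda>n. real_of_rat (q s n)) \<longlonglongrightarrow> r s))"

definition upper_semicomputable :: "(sit \<Rightarrow> real) \<Rightarrow> bool" where
  "upper_semicomputable r \<longleftrightarrow> lower_semicomputable (\<lambda>s. - r s)"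

definition computable_real_map :: "(sit \<Rightarrow> real) \<Rightarrow> bool" where
  "computable_real_map r \<longleftrightarrow> lower_semicomputable r \<and> upper_semicomputable r"

definition computable_fs :: "(sit \<Rightarrow> real set) \<Rightarrow> bool" where
  "computable_fs \<phi> \<longleftrightarrow> computable_real_map (lower_fc \<phi>) \<and> computable_real_map (upper_fc \<phi>)"

definition ml_random :: "(sit \<Rightarrow> real set) \<Rightarrow> path \<Rightarrow> bool" where
  "ml_random \<phi> \<omega> \<longleftrightarrow> (\<forall>T. lower_semicomputable T \<and> test_supermartingale \<phi> T \<longrightarrow>
      bdd_above (range (\<lambda>n. T (prefix \<omega> n))))"

definition ml_test :: "(sit \<Rightarrow> real set) \<Rightarrow> (nat \<times> sit) set \<Rightarrow> bool" where
  "ml_test \<phi> A \<longleftrightarrow> rec_enum (code_ns ` A) \<and>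
     (\<forall>n. upper_prob \<phi> (cylset (section_at A n)) \<le> ereal ((1/2) ^ n))"

definition ml_test_random :: "(sit \<Rightarrow> real set) \<Rightarrow> path \<Rightarrow> bool" where
  "ml_test_random \<phi> \<omega> \<longleftrightarrow> (\<forall>A. ml_test \<phi> A \<longrightarrow> \<omega> \<notin> (\<Inter>n. cylset (section_at A n)))"

end

theory Submission
  imports Defs
begin

text \<open>
  If \<open>T\<close> is a test supermartingale, then by Ville's inequality the situations with
  \<open>T s > 2 ^ n\<close> form a Martin-Loef test, and a path along which \<open>T\<close> is unbounded
  meets all its sections.

  Conversely, the conditional upper probability of ever visiting the \<open>n\<close>-th section of a test
  is the limit of a backward recursion over finitely many situations. Because all values are
  non-negative, running the recursion with lower approximations of \<open>p\<close> and of \<open>1 - p\<close>, for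
  \<open>p\<close> an endpoint of the forecast, keeps it monotone and rational. The mixture of the even
  sections with weights \<open>2 ^ n / 2\<close> is a lower semicomputable supermartingale; it is
  finite because non-degeneracy bounds the growth of a non-negative supermartingale along each
  situation.
\<close>

section \<open>Total recursive functions and computability on encoded types\<close>

text \<open>The infimum in \<open>upper_prob\<close> ranges over supermartingales that may be
  uncomputable, and it need not be attained, so a test comes with no effective witness for the
  smallness of its sections. The way out is a quantity that is computed from below and lies under
  all dominating supermartingales at once: a bound linear in \<open>M []\<close> that all of them
  satisfy then passes to the infimum. A second obstacle is that the forecasts are known only through
  approximations, while a supermartingale must obey the exact inequality. At a finite stage the
  approximate weights of the two children sum to at most 1, and the exact weights appear only in the
  limit. Even sections are used because section \<open>2 * n\<close> has upper probability at most
  \<open>(1/4) ^ n\<close>, so a weight growing like \<open>2 ^ n\<close> still leaves a geometric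
  series.\<close>

definition recn :: "nat \<Rightarrow> (nat list \<Rightarrow> nat) \<Rightarrow> bool" where
  "recn k F \<longleftrightarrow> (\<exists>r. \<forall>xs. length xs = k \<longrightarrow> eval_recf r xs (F xs))"

lemma recn_cong: "(\<And>xs. length xs = k \<Longrightarrow> F xs = G xs) \<Longrightarrow> recn k F = recn k G"
  by (auto simp: recn_def)

lemma recn_zero: "recn k (\<lambda>_. 0)"
  unfolding recn_def using eval_recf.zero by blast

lemma recn_proj: "i < k \<Longrightarrow> recn k (\<lambda>xs. xs ! i)"
  unfolding recn_def using eval_recf.proj by blast

lemma recn_drop_nth:
  assumes "m + i < k" shows "recn k (\<lambda>xs. drop m xs ! i)"
  using recn_proj[OF assms] by (subst recn_cong[of _ _ "\<lambda>xs. xs ! (m + i)"]) (use assms in auto)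

lemma recn_compose:
  assumes "recn m G" "length Fs = m" "\<And>F. F \<in> set Fs \<Longrightarrow> recn k F"
  shows "recn k (\<lambda>xs. G (map (\<lambda>F. F xs) Fs))"
proof -
  obtain g where g: "\<And>ys. length ys = m \<Longrightarrow> eval_recf g ys (G ys)"
    using assms(1) by (auto simp: recn_def)
  obtain c where c: "\<And>F xs. F \<in> set Fs \<Longrightarrow> length xs = k \<Longrightarrow> eval_recf (c F) xs (F xs)"
    using assms(3) unfolding recn_def by metis
  have "eval_recf (Cnf g (map c Fs)) xs (G (map (\<lambda>F. F xs) Fs))" if "length xs = k" for xs
    using that c g assms(2)
    by (intro eval_recf.comp[where ys = "map (\<lambda>F. F xs) Fs"])
      (auto simp: list_all2_conv_all_nth)
  thus ?thesis unfolding recn_def by blast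
qed

lemma recn_Suc: "recn k F \<Longrightarrow> recn k (\<lambda>xs. Suc (F xs))"
proof -
  have "recn 1 (\<lambda>ys. Suc (hd ys))"
    unfolding recn_def
    by (rule exI[of _ Sf]) (auto simp: length_Suc_conv intro: eval_recf.succ)
  then show "recn k F \<Longrightarrow> recn k (\<lambda>xs. Suc (F xs))"
    using recn_compose[of 1 "\<lambda>ys. Suc (hd ys)" "[F]" k] by simp
qed

lemma recn_compose1:
  assumes "recn 1 (\<lambda>ys. f (ys ! 0))" "recn k F"
  shows "recn k (\<lambda>xs. f (F xs))"
  using recn_compose[of 1 _ "[F]" k, OF assms(1)] assms(2) by simp

lemma recn_compose2:
  assumes "recn 2 (\<lambda>ys. f (ys ! 0) (ys ! 1))" "recn k F" "recn k G"
  shows "recn k (\<lambda>xs. f (F xs) (G xs))"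
proof -
  have "recn k (\<lambda>xs. (\<lambda>ys. f (ys ! 0) (ys ! 1)) (map (\<lambda>F. F xs) [F, G]))"
    by (rule recn_compose[OF assms(1)]) (use assms in auto)
  thus ?thesis by simp
qed

lemma recn_rec_nat:
  assumes N: "recn k N" and A: "recn k A"
    and B: "recn (Suc (Suc k)) (\<lambda>ys. B (ys ! 1) (ys ! 0) (drop 2 ys))"
  shows "recn k (\<lambda>xs. rec_nat (A xs) (\<lambda>n y. B n y xs) (N xs))"
proof -
  obtain a where a: "\<And>xs. length xs = k \<Longrightarrow> eval_recf a xs (A xs)"
    using A by (auto simp: recn_def)
  obtain b where b: "\<And>ys. length ys = Suc (Suc k) \<Longrightarrow> eval_recf b ys (B (ys ! 1) (ys ! 0) (drop 2 ys))"
    using B by (auto simp: recn_def)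
  have *: "eval_recf (Prf a b) (n # xs) (rec_nat (A xs) (\<lambda>n y. B n y xs) n)"
    if "length xs = k" for n xs
  proof (induction n)
    case (Suc n)
    show ?case
      using eval_recf.prS[OF Suc] b[of "rec_nat (A xs) (\<lambda>n y. B n y xs) n # n # xs"] that
      by simp
  qed (auto intro: eval_recf.pr0 a that)
  let ?R = "\<lambda>ys. rec_nat (A (tl ys)) (\<lambda>n y. B n y (tl ys)) (hd ys)"
  have "recn (Suc k) ?R"
    unfolding recn_def using * by (intro exI[of _ "Prf a b"]) (auto simp: length_Suc_conv)
  \<comment> \<open>\<open>Prf\<close> recurses on its first argument only; feeding it
    \<open>N\<close> followed by all \<open>k\<close> projections turns that into recursion up to an
    arbitrary \<open>N xs\<close> with \<open>xs\<close> itself as parameters.\<close>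
  then have "recn k (\<lambda>xs. ?R (map (\<lambda>F. F xs) (N # map (\<lambda>i xs. xs ! i) [0..<k])))"
    by (rule recn_compose) (use N in \<open>auto intro: recn_proj\<close>)
  then show ?thesis
    by (rule recn_cong[THEN iffD1, rotated]) (simp add: comp_def, metis map_nth)
qed

lemma recn_Least:
  assumes F: "recn (Suc k) (\<lambda>ys. F (ys ! 0) (tl ys))"
    and ex: "\<And>xs. length xs = k \<Longrightarrow> \<exists>n. F n xs = 0"
  shows "recn k (\<lambda>xs. LEAST n. F n xs = 0)"
proof -
  obtain f where f: "\<And>ys. length ys = Suc k \<Longrightarrow> eval_recf f ys (F (ys ! 0) (tl ys))"
    using F by (auto simp: recn_def)
  have "eval_recf (Mnf f) xs (LEAST n. F n xs = 0)" if "length xs = k" for xs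
  proof (rule eval_recf.mn)
    let ?n = "LEAST n. F n xs = 0"
    show "eval_recf f (?n # xs) 0"
      using f[of "?n # xs"] LeastI_ex[OF ex[OF that]] that by simp
    show "\<forall>m<?n. \<exists>k. eval_recf f (m # xs) (Suc k)"
    proof (intro allI impI)
      fix m assume "m < ?n"
      then have "F m xs \<noteq> 0" by (rule not_less_Least)
      then show "\<exists>k. eval_recf f (m # xs) (Suc k)"
        using f[of "m # xs"] that by (metis length_Cons list.sel(3) not0_implies_Suc nth_Cons_0)
    qed
  qed
  thus ?thesis unfolding recn_def by blast
qed

lemma recn_const: "recn k (\<lambda>_. c)"
  by (induction c) (auto intro: recn_zero recn_Suc)

lemma recn_add: "recn k F \<Longrightarrow> recn k G \<Longrightarrow> recn k (\<lambda>xs. F xs + G xs)"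
proof (rule recn_compose2[of "(+)"])
  have "rec_nat b (\<lambda>_ y. Suc y) a = a + b" for a b by (induction a) auto
  moreover have "recn 2 (\<lambda>ys. rec_nat (ys ! 1) (\<lambda>n y. Suc y) (ys ! 0))"
    by (intro recn_rec_nat recn_proj recn_Suc) auto
  ultimately show "recn 2 (\<lambda>ys. ys ! 0 + ys ! 1)" by simp
qed

lemma recn_pred: "recn k F \<Longrightarrow> recn k (\<lambda>xs. F xs - 1)"
proof -
  assume F: "recn k F"
  have "rec_nat 0 (\<lambda>n y. n) a = a - 1" for a by (induction a) auto
  moreover have "recn k (\<lambda>xs. rec_nat 0 (\<lambda>n y. n) (F xs))"
    by (intro recn_rec_nat recn_proj recn_zero F) auto
  ultimately show ?thesis by simp
qed

lemma recn_diff: "recn k F \<Longrightarrow> recn k G \<Longrightarrow> recn k (\<lambda>xs. F xs - G xs)"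
proof (rule recn_compose2[of "(-)"])
  have "rec_nat a (\<lambda>_ y. y - 1) b = a - b" for a b :: nat by (induction b) auto
  moreover have "recn 2 (\<lambda>ys. rec_nat (ys ! 0) (\<lambda>n y. y - 1) (ys ! 1))"
    by (intro recn_rec_nat recn_proj recn_pred) auto
  ultimately show "recn 2 (\<lambda>ys. ys ! 0 - ys ! 1)" by simp
qed

lemma recn_triangle: "recn k F \<Longrightarrow> recn k (\<lambda>xs. triangle (F xs))"
proof -
  assume F: "recn k F"
  have "rec_nat 0 (\<lambda>n y. y + Suc n) a = triangle a" for a by (induction a) auto
  moreover have "recn k (\<lambda>xs. rec_nat 0 (\<lambda>n y. y + Suc n) (F xs))"
    by (intro recn_rec_nat recn_proj recn_zero recn_add recn_Suc F) auto
  ultimately show ?thesis by simp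
qed

lemma recn_prod_encode:
  "recn k F \<Longrightarrow> recn k G \<Longrightarrow> recn k (\<lambda>xs. prod_encode (F xs, G xs))"
  unfolding prod_encode_def by (simp add: recn_add recn_triangle)

text \<open>The sum of the two components of the pair coded by \<open>z\<close>.\<close>

definition pair_diag :: "nat \<Rightarrow> nat" where
  "pair_diag z = (LEAST n. Suc z - triangle (Suc n) = 0)"

lemma triangle_mono: "m \<le> n \<Longrightarrow> triangle m \<le> triangle n"
  by (rule lift_Suc_mono_le) auto

lemma pair_diag_prod_encode: "pair_diag (prod_encode (a, b)) = a + b"
  unfolding pair_diag_def
proof (rule Least_equality)
  show "Suc (prod_encode (a, b)) - triangle (Suc (a + b)) = 0"
    by (simp add: prod_encode_def)
next
  fix n assume n: "Suc (prod_encode (a, b)) - triangle (Suc n) = 0"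
  show "a + b \<le> n"
  proof (rule ccontr)
    assume "\<not> a + b \<le> n"
    then have "triangle (Suc n) \<le> triangle (a + b)" by (intro triangle_mono) auto
    with n show False by (simp add: prod_encode_def)
  qed
qed

lemma recn_pair_diag: "recn k F \<Longrightarrow> recn k (\<lambda>xs. pair_diag (F xs))"
proof (rule recn_compose1[of pair_diag])
  have ex: "\<exists>n. Suc z - triangle (Suc n) = 0" for z
    by (rule exI[of _ z]) simp
  have tl: "recn (Suc 1) (\<lambda>ys. tl ys ! 0)"
    by (subst recn_cong[of _ _ "\<lambda>ys. ys ! 1"]) (auto simp: nth_tl intro: recn_proj)
  show "recn 1 (\<lambda>ys. pair_diag (ys ! 0))"
    unfolding pair_diag_def
    by (intro recn_Least recn_diff recn_Suc recn_triangle tl recn_proj ex) auto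
qed

lemma recn_fst_prod_decode: "recn k F \<Longrightarrow> recn k (\<lambda>xs. fst (prod_decode (F xs)))"
proof -
  \<comment> \<open>\<open>prod_encode (a, b) = triangle (a + b) + a\<close>, so the diagonal
    \<open>a + b\<close> gives the first component by subtraction.\<close>
  have "fst (prod_decode z) = z - triangle (pair_diag z)" for z
  proof (cases "prod_decode z")
    case (Pair a b)
    then have "z = prod_encode (a, b)" by (metis prod_decode_inverse)
    then show ?thesis by (simp add: pair_diag_prod_encode) (simp add: prod_encode_def)
  qed
  then show "recn k F \<Longrightarrow> recn k (\<lambda>xs. fst (prod_decode (F xs)))"
    by (simp add: recn_diff recn_triangle recn_pair_diag)
qed

lemma recn_snd_prod_decode: "recn k F \<Longrightarrow> recn k (\<lambda>xs. snd (prod_decode (F xs)))"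
proof -
  have "snd (prod_decode z) = pair_diag z - fst (prod_decode z)" for z
    using pair_diag_prod_encode[of "fst (prod_decode z)" "snd (prod_decode z)"] by simp
  then show "recn k F \<Longrightarrow> recn k (\<lambda>xs. snd (prod_decode (F xs)))"
    by (simp add: recn_diff recn_fst_prod_decode recn_pair_diag)
qed

lemma recursive_fun_iff_recn: "recursive_fun f \<longleftrightarrow> recn 1 (\<lambda>xs. f (xs ! 0))"
  unfolding recursive_fun_def recn_def
proof (intro iffI; elim exE)
  fix r assume "\<forall>n. eval_recf r [n] (f n)"
  then show "\<exists>r. \<forall>xs. length xs = 1 \<longrightarrow> eval_recf r xs (f (xs ! 0))"
    by (intro exI[of _ r]) (auto simp: length_Suc_conv)
next
  fix r assume r: "\<forall>xs. length xs = 1 \<longrightarrow> eval_recf r xs (f (xs ! 0))"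
  then show "\<exists>r. \<forall>n. eval_recf r [n] (f n)"
    by (metis length_Cons list.size(3) nth_Cons_0 One_nat_def)
qed

lemma recn_recursive_fun: "recursive_fun f \<Longrightarrow> recn k F \<Longrightarrow> recn k (\<lambda>xs. f (F xs))"
  unfolding recursive_fun_iff_recn by (rule recn_compose1)

lemma recursive_funI: "recn 1 (\<lambda>xs. f (xs ! 0)) \<Longrightarrow> recursive_fun f"
  by (simp add: recursive_fun_iff_recn)

section \<open>Computable maps between types with a numeric coding\<close>

class encodable =
  fixes enc :: "'a \<Rightarrow> nat" and dec :: "nat \<Rightarrow> 'a"
  assumes dec_enc [simp]: "dec (enc x) = x"

lemma enc_eq_iff [simp]: "enc x = enc y \<longleftrightarrow> x = y"
  by (metis dec_enc)

instantiation nat :: encodable begin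
definition enc_nat_def [simp]: "enc (n::nat) = n"
definition dec_nat_def [simp]: "dec n = (n::nat)"
instance by standard simp
end

instantiation bool :: encodable begin
definition enc_bool_def: "enc b = (if b then 1 else 0::nat)"
definition dec_bool_def: "dec n \<longleftrightarrow> n = (1::nat)"
instance by standard (simp add: enc_bool_def dec_bool_def)
end

instantiation prod :: (encodable, encodable) encodable begin
definition enc_prod_def: "enc p = prod_encode (enc (fst p), enc (snd p))"
definition dec_prod_def: "dec n = map_prod dec dec (prod_decode n)"
instance by standard (simp add: enc_prod_def dec_prod_def)
end

instantiation list :: (encodable) encodable begin
definition enc_list_def: "enc xs = list_encode (map enc xs)"
definition dec_list_def: "dec n = map dec (list_decode n)"
instance by standard (simp add: enc_list_def dec_list_def comp_def)
end

instantiation option :: (encodable) encodable begin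
definition enc_option_def: "enc x = (case x of None \<Rightarrow> 0 | Some y \<Rightarrow> Suc (enc y))"
definition dec_option_def: "dec n = (case n of 0 \<Rightarrow> None | Suc m \<Rightarrow> Some (dec m))"
instance by standard (simp add: enc_option_def dec_option_def split: option.split)
end

lemma enc_Nil [simp]: "enc [] = 0"
  and enc_Cons: "enc (x # xs) = Suc (prod_encode (enc x, enc xs))"
  by (simp_all add: enc_list_def)

text \<open>Only codes are constrained: \<open>g\<close> is total, but its values at numbers outside
  the range of \<open>enc\<close> are arbitrary. This matters because \<open>dec\<close> is only a
  left inverse of \<open>enc\<close>: not every number codes a boolean or a list of
  booleans.\<close>

definition computable :: "('a::encodable \<Rightarrow> 'b::encodable) \<Rightarrow> bool" where
  "computable f \<longleftrightarrow> (\<exists>g. recursive_fun g \<and> (\<forall>x. g (enc x) = enc (f x)))"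

named_theorems computable_intros

lemma computableE:
  assumes "computable f"
  obtains g where "\<And>k F. recn k F \<Longrightarrow> recn k (\<lambda>xs. g (F xs))" "\<And>x. g (enc x) = enc (f x)"
  using assms recn_recursive_fun unfolding computable_def by metis

lemma computableI:
  "recn 1 (\<lambda>xs. g (xs ! 0)) \<Longrightarrow> (\<And>x. g (enc x) = enc (f x)) \<Longrightarrow> computable f"
  unfolding computable_def using recursive_funI by blast

lemma computable_compose: "computable f \<Longrightarrow> computable g \<Longrightarrow> computable (\<lambda>x. f (g x))"
  unfolding computable_def
proof (elim exE conjE)
  fix f' g'
  assume "recursive_fun f'" "\<forall>x. f' (enc x) = enc (f x)"
    "recursive_fun g'" "\<forall>x. g' (enc x) = enc (g x)"
  then show "\<exists>h. recursive_fun h \<and> (\<forall>x. h (enc x) = enc (f (g x)))"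
    by (intro exI[of _ "\<lambda>z. f' (g' z)"])
      (auto intro!: recursive_funI recn_recursive_fun[of f'] recn_recursive_fun[of g'] recn_proj)
qed

lemma computable_lift2:
  assumes op: "\<And>k F G. recn k F \<Longrightarrow> recn k G \<Longrightarrow> recn k (\<lambda>xs. op (F xs) (G xs))"
    and h: "\<And>y z. op (enc y) (enc z) = enc (h y z)"
    and f: "computable f" and g: "computable g"
  shows "computable (\<lambda>x. h (f x) (g x))"
proof -
  obtain f' where f': "\<And>k F. recn k F \<Longrightarrow> recn k (\<lambda>xs. f' (F xs))" "\<And>x. f' (enc x) = enc (f x)"
    using f by (rule computableE) auto
  obtain g' where g': "\<And>k F. recn k F \<Longrightarrow> recn k (\<lambda>xs. g' (F xs))" "\<And>x. g' (enc x) = enc (g x)"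
    using g by (rule computableE) auto
  show ?thesis
    by (rule computableI[of "\<lambda>z. op (f' z) (g' z)"])
      (auto intro!: op f' g' recn_proj simp: f'(2) g'(2) h)
qed

lemma computable_id [computable_intros]: "computable (\<lambda>x. x)"
  by (rule computableI[of "\<lambda>x. x"]) (auto intro: recn_proj)

lemma computable_const [computable_intros]: "computable (\<lambda>x. c)"
  by (rule computableI[of "\<lambda>x. enc c"]) (auto intro: recn_const)

lemma computable_Pair [computable_intros]:
  assumes "computable f" "computable g"
  shows "computable (\<lambda>x. (f x, g x))"
  by (rule computable_lift2[OF recn_prod_encode _ assms]) (auto simp: enc_prod_def)

lemma computable_fst [computable_intros]:
  assumes "computable f" shows "computable (\<lambda>x. fst (f x))"
  by (rule computable_compose[OF _ assms], rule computableI[of "\<lambda>x. fst (prod_decode x)"])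
    (auto intro: recn_fst_prod_decode recn_proj simp: enc_prod_def)

lemma computable_snd [computable_intros]:
  assumes "computable f" shows "computable (\<lambda>x. snd (f x))"
  by (rule computable_compose[OF _ assms], rule computableI[of "\<lambda>x. snd (prod_decode x)"])
    (auto intro: recn_snd_prod_decode recn_proj simp: enc_prod_def)

lemma computable_compose2:
  "computable (\<lambda>p. f (fst p) (snd p)) \<Longrightarrow> computable g \<Longrightarrow> computable h \<Longrightarrow>
    computable (\<lambda>x. f (g x) (h x))"
  using computable_compose[of "\<lambda>p. f (fst p) (snd p)" "\<lambda>x. (g x, h x)"]
  by (simp add: computable_Pair)

lemma computable_compose3:
  "computable (\<lambda>p. f (fst p) (fst (snd p)) (snd (snd p))) \<Longrightarrow>
    computable g \<Longrightarrow> computable h \<Longrightarrow> computable i \<Longrightarrow> computable (\<lambda>x. f (g x) (h x) (i x))"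
  using computable_compose[of "\<lambda>p. f (fst p) (fst (snd p)) (snd (snd p))" "\<lambda>x. (g x, h x, i x)"]
  by (simp add: computable_Pair)

lemma computable_rec_nat [computable_intros]:
  fixes A :: "'a::encodable \<Rightarrow> 'b::encodable"
  assumes A: "computable A" and B: "computable (\<lambda>p. B (fst p) (fst (snd p)) (snd (snd p)))"
    and N: "computable N"
  shows "computable (\<lambda>x. rec_nat (A x) (B x) (N x))"
proof -
  obtain a where a: "\<And>k F. recn k F \<Longrightarrow> recn k (\<lambda>xs. a (F xs))" "\<And>x. a (enc x) = enc (A x)"
    using A by (rule computableE) auto
  obtain n where n: "\<And>k F. recn k F \<Longrightarrow> recn k (\<lambda>xs. n (F xs))" "\<And>x. n (enc x) = enc (N x)"
    using N by (rule computableE) auto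
  obtain b where b: "\<And>k F. recn k F \<Longrightarrow> recn k (\<lambda>xs. b (F xs))"
    "\<And>p. b (enc p) = enc (B (fst p) (fst (snd p)) (snd (snd p)))"
    using B by (rule computableE) auto
  define g where "g = (\<lambda>z. rec_nat (a z) (\<lambda>i y. b (prod_encode (z, prod_encode (i, y)))) (n z))"
  show ?thesis
  proof (rule computableI)
    show "recn 1 (\<lambda>xs. g (xs ! 0))"
      unfolding g_def
      by (intro recn_rec_nat a(1) b(1) n(1) recn_prod_encode recn_proj recn_drop_nth) auto
    have "rec_nat (a (enc x)) (\<lambda>i y. b (prod_encode (enc x, prod_encode (i, y)))) m
        = enc (rec_nat (A x) (B x) m)" for x m
    proof (induction m)
      case (Suc m)
      then show ?case using b(2)[of "(x, m, rec_nat (A x) (B x) m)"] by (simp add: enc_prod_def)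
    qed (simp add: a)
    then show "g (enc x) = enc (rec_nat (A x) (B x) (N x))" for x
      by (simp add: g_def n)
  qed
qed

lemma computable_Suc [computable_intros]: "computable f \<Longrightarrow> computable (\<lambda>x. Suc (f x))"
  by (rule computable_compose[of Suc]) (auto intro!: computableI[of Suc] recn_Suc recn_proj)

text \<open>Primitive recursion with a step that ignores the accumulated value: zero rounds give
  \<open>A\<close>, any positive number of rounds gives \<open>B\<close>.\<close>

lemma recn_if_zero:
  assumes "recn k C" "recn k A" "recn k B"
  shows "recn k (\<lambda>xs. if C xs = 0 then A xs else B xs)"
proof -
  have "recn (Suc (Suc k)) (\<lambda>ys. B (map (\<lambda>F. F ys) (map (\<lambda>i ys. ys ! (i + 2)) [0..<k])))"
    by (rule recn_compose[OF assms(3)]) (auto intro: recn_proj)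
  then have "recn (Suc (Suc k)) (\<lambda>ys. B (drop 2 ys))"
    by (rule recn_cong[THEN iffD1, rotated]) (auto intro!: arg_cong[of _ _ B] nth_equalityI)
  then have "recn k (\<lambda>xs. rec_nat (A xs) (\<lambda>n y. B xs) (C xs))"
    by (intro recn_rec_nat assms)
  moreover have "rec_nat a (\<lambda>n y. b) c = (if c = 0 then a else b)" for a b c :: nat
    by (cases c) auto
  ultimately show ?thesis by simp
qed

lemma computable_If [computable_intros]:
  assumes "computable P" "computable A" "computable B"
  shows "computable (\<lambda>x. if P x then A x else B x)"
proof -
  have "computable (\<lambda>x. (\<lambda>b p. if b then fst p else snd p) (P x) (A x, B x))"
    by (rule computable_lift2[of "\<lambda>b p. if b = 0 then snd (prod_decode p) else fst (prod_decode p)"])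
      (auto intro!: recn_if_zero recn_fst_prod_decode recn_snd_prod_decode computable_Pair assms
        simp: enc_bool_def enc_prod_def)
  then show ?thesis by (simp cong: if_cong)
qed

lemma computable_case_option [computable_intros]:
  assumes A: "computable A" and B: "computable (\<lambda>p. B (fst p) (snd p))" and C: "computable C"
  shows "computable (\<lambda>x. case C x of None \<Rightarrow> A x | Some y \<Rightarrow> B x y)"
proof -
  obtain a where a: "\<And>k F. recn k F \<Longrightarrow> recn k (\<lambda>xs. a (F xs))" "\<And>x. a (enc x) = enc (A x)"
    using A by (rule computableE) auto
  obtain c where c: "\<And>k F. recn k F \<Longrightarrow> recn k (\<lambda>xs. c (F xs))" "\<And>x. c (enc x) = enc (C x)"
    using C by (rule computableE) auto
  obtain b where b: "\<And>k F. recn k F \<Longrightarrow> recn k (\<lambda>xs. b (F xs))"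
    "\<And>p. b (enc p) = enc (B (fst p) (snd p))"
    using B by (rule computableE) auto
  have *: "b (prod_encode (enc x, enc y)) = enc (B x y)" for x y
    using b(2)[of "(x, y)"] by (simp add: enc_prod_def)
  show ?thesis
  proof (rule computableI[of "\<lambda>z. if c z = 0 then a z else b (prod_encode (z, c z - 1))"])
    show "recn 1 (\<lambda>xs. if c (xs ! 0) = 0 then a (xs ! 0)
        else b (prod_encode (xs ! 0, c (xs ! 0) - 1)))"
      by (intro recn_if_zero a(1) b(1) c(1) recn_prod_encode recn_pred recn_proj) auto
  qed (auto simp: a(2) c(2) * enc_option_def split: option.split)
qed

lemma computable_case_list [computable_intros]:
  assumes A: "computable A" and B: "computable (\<lambda>p. B (fst p) (fst (snd p)) (snd (snd p)))"
    and C: "computable C"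
  shows "computable (\<lambda>x. case C x of [] \<Rightarrow> A x | y # ys \<Rightarrow> B x y ys)"
proof -
  define opt where "opt l = (case l of [] \<Rightarrow> None | y # ys \<Rightarrow> Some (y, ys))" for l :: "'c list"
  \<comment> \<open>A list code is 0 or \<open>Suc\<close> of a pair code, which is already the code
    of an optional pair, so \<open>opt\<close> acts as the identity on codes.\<close>
  have opt: "computable opt"
    by (rule computableI[of "\<lambda>z. z"])
      (auto simp: opt_def enc_option_def enc_Cons enc_prod_def intro: recn_proj split: list.split)
  have "computable (\<lambda>x. case opt (C x) of None \<Rightarrow> A x | Some y \<Rightarrow> B x (fst y) (snd y))"
    by (intro computable_case_option computable_compose[OF opt] A B C)
  moreover have "(case opt (C x) of None \<Rightarrow> A x | Some y \<Rightarrow> B x (fst y) (snd y))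
      = (case C x of [] \<Rightarrow> A x | y # ys \<Rightarrow> B x y ys)" for x
    by (simp add: opt_def split: list.split)
  ultimately show ?thesis by simp
qed

lemma computable_Cons [computable_intros]:
  assumes "computable f" "computable g"
  shows "computable (\<lambda>x. f x # g x)"
  by (rule computable_lift2[OF recn_Suc[OF recn_prod_encode] _ assms]) (auto simp: enc_Cons)

lemma computable_Some [computable_intros]:
  "computable f \<Longrightarrow> computable (\<lambda>x. Some (f x))"
  by (rule computable_compose[of Some])
    (auto intro!: computableI[of Suc] recn_Suc recn_proj simp: enc_option_def)

lemma computable_enc [computable_intros]: "computable f \<Longrightarrow> computable (\<lambda>x. enc (f x))"
  by (rule computable_compose[of enc]) (auto intro!: computableI[of "\<lambda>x. x"] recn_proj)

lemma computable_add [computable_intros]: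
  fixes f g :: "'a::encodable \<Rightarrow> nat"
  assumes "computable f" "computable g"
  shows "computable (\<lambda>x. f x + g x)"
  by (rule computable_lift2[OF recn_add _ assms]) auto

lemma computable_diff [computable_intros]:
  fixes f g :: "'a::encodable \<Rightarrow> nat"
  assumes "computable f" "computable g"
  shows "computable (\<lambda>x. f x - g x)"
  by (rule computable_lift2[OF recn_diff _ assms]) auto

lemma computable_mult [computable_intros]:
  fixes f g :: "'a::encodable \<Rightarrow> nat"
  assumes "computable f" "computable g"
  shows "computable (\<lambda>x. f x * g x)"
proof -
  have "rec_nat 0 (\<lambda>_ v. v + b) a = a * b" for a b :: nat by (induction a) auto
  moreover have "computable (\<lambda>x. rec_nat 0 (\<lambda>_ v. v + g x) (f x))"
    by (intro computable_intros computable_compose[OF assms(2)] assms)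
  ultimately show ?thesis by simp
qed

lemma computable_power2 [computable_intros]:
  assumes "computable f" shows "computable (\<lambda>x. 2 ^ f x :: nat)"
proof -
  have "rec_nat (1::nat) (\<lambda>_ v. 2 * v) a = 2 ^ a" for a by (induction a) auto
  moreover have "computable (\<lambda>x. rec_nat (1::nat) (\<lambda>_ v. 2 * v) (f x))"
    by (intro computable_intros assms)
  ultimately show ?thesis by simp
qed

lemma computable_eq_0 [computable_intros]:
  fixes f :: "'a::encodable \<Rightarrow> nat"
  assumes "computable f" shows "computable (\<lambda>x. f x = 0)"
proof -
  have "computable (\<lambda>x. rec_nat True (\<lambda>_ _. False) (f x))"
    by (intro computable_intros assms)
  moreover have "rec_nat True (\<lambda>_ _. False) a = (a = 0)" for a by (cases a) auto
  ultimately show ?thesis by simp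
qed

lemma computable_le [computable_intros]:
  fixes f g :: "'a::encodable \<Rightarrow> nat"
  assumes "computable f" "computable g" shows "computable (\<lambda>x. f x \<le> g x)"
  using computable_eq_0[OF computable_diff[OF assms]] by simp

lemma computable_less [computable_intros]:
  fixes f g :: "'a::encodable \<Rightarrow> nat"
  assumes "computable f" "computable g" shows "computable (\<lambda>x. f x < g x)"
  using computable_le[OF computable_Suc[OF assms(1)] assms(2)] by (simp add: Suc_le_eq)

lemma computable_conj [computable_intros]:
  assumes "computable P" "computable Q" shows "computable (\<lambda>x. P x \<and> Q x)"
proof -
  have "computable (\<lambda>x. if P x then Q x else False)"
    by (intro computable_intros assms)
  moreover have "(if P x then Q x else False) = (P x \<and> Q x)" for x by simp
  ultimately show ?thesis by simp
qed

lemma computable_disj [computable_intros]: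
  assumes "computable P" "computable Q" shows "computable (\<lambda>x. P x \<or> Q x)"
proof -
  have "computable (\<lambda>x. if P x then True else Q x)"
    by (intro computable_intros assms)
  moreover have "(if P x then True else Q x) = (P x \<or> Q x)" for x by simp
  ultimately show ?thesis by simp
qed

lemma computable_eq_nat [computable_intros]:
  fixes f g :: "'a::encodable \<Rightarrow> nat"
  assumes "computable f" "computable g" shows "computable (\<lambda>x. f x = g x)"
  unfolding order.eq_iff by (intro computable_intros assms)

lemma computable_bex [computable_intros]:
  fixes P :: "'a::encodable \<Rightarrow> nat \<Rightarrow> bool"
  assumes "computable (\<lambda>p. P (fst p) (snd p))" "computable N"
  shows "computable (\<lambda>x. \<exists>i<N x. P x i)"
proof -
  have "computable (\<lambda>x. rec_nat False (\<lambda>i v. v \<or> P x i) (N x))"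
    by (intro computable_intros computable_compose2[OF assms(1)] assms(2))
  moreover have "rec_nat False (\<lambda>i v. v \<or> P x i) n = (\<exists>i<n. P x i)" for x n
    by (induction n) (auto simp: less_Suc_eq)
  ultimately show ?thesis by simp
qed

lemma length_le_enc: "length xs \<le> enc xs"
  by (induction xs) (auto simp: enc_Cons intro: order_trans[OF _ le_prod_encode_2])

text \<open>Recursion over a list is simulated by recursion over numbers: the state holds the
  accumulator and the rest of the list, and the step idles once the list is empty. Any bound on the
  length can therefore serve as the number of rounds, and the code of the list is one
  (\<open>length_le_enc\<close>).\<close>

lemma computable_foldl [computable_intros]:
  assumes f: "computable (\<lambda>p. f (fst p) (fst (snd p)) (snd (snd p)))"
    and A: "computable A" and L: "computable L"
  shows "computable (\<lambda>x. foldl (f x) (A x) (L x))"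
proof -
  define step where
    "step x = (\<lambda>(i::nat) st. case snd st of [] \<Rightarrow> st | y # ys \<Rightarrow> (f x (fst st) y, ys))" for x
  have "computable (\<lambda>x. fst (rec_nat (A x, L x) (step x) (enc (L x))))"
    unfolding step_def by (intro computable_intros computable_compose3[OF f] A L)
  moreover have "rec_nat (a, l) (step x) n = (foldl (f x) a (take n l), drop n l)" for x a l n
  proof (induction n)
    case (Suc n)
    show ?case
    proof (cases "drop n l")
      case Nil
      then show ?thesis using Suc by (simp add: step_def)
    next
      case (Cons y ys)
      then have "n < length l" "y = l ! n" "ys = drop (Suc n) l"
        by (metis drop_eq_Nil2 linorder_not_less list.distinct(1),
            metis nth_via_drop, metis drop_Suc list.sel(3) tl_drop)
      then show ?thesis using Suc Cons by (simp add: step_def take_Suc_conv_app_nth)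
    qed
  qed simp
  ultimately show ?thesis by (simp add: length_le_enc)
qed

lemma computable_rev [computable_intros]:
  assumes "computable f" shows "computable (\<lambda>x. rev (f x))"
proof -
  have "computable (\<lambda>x. foldl (\<lambda>a y. y # a) [] (f x))"
    by (intro computable_intros assms)
  moreover have "foldl (\<lambda>a y. y # a) a l = rev l @ a" for a l :: "'b list"
    by (induction l arbitrary: a) auto
  ultimately show ?thesis by simp
qed

lemma computable_snoc [computable_intros]:
  assumes "computable f" "computable g" shows "computable (\<lambda>x. f x @ [g x])"
proof -
  have "computable (\<lambda>x. rev (g x # rev (f x)))"
    by (intro computable_intros assms)
  then show ?thesis by simp
qed

lemma computable_map [computable_intros]:
  assumes "computable (\<lambda>p. f (fst p) (snd p))" "computable g"
  shows "computable (\<lambda>x. map (f x) (g x))"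
proof -
  have "computable (\<lambda>x. foldl (\<lambda>a y. a @ [f x y]) [] (g x))"
    by (intro computable_intros computable_compose2[OF assms(1)] assms(2))
  moreover have "foldl (\<lambda>a y. a @ [f x y]) a l = a @ map (f x) l" for a l x
    by (induction l arbitrary: a) auto
  ultimately show ?thesis by simp
qed

lemma computable_drop [computable_intros]:
  assumes "computable n" "computable f"
  shows "computable (\<lambda>x. drop (n x) (f x))"
proof -
  have "computable (\<lambda>x. rec_nat (f x) (\<lambda>_ l. case l of [] \<Rightarrow> [] | y # ys \<Rightarrow> ys) (n x))"
    by (intro computable_intros assms)
  moreover have "rec_nat l (\<lambda>_ l. case l of [] \<Rightarrow> [] | y # ys \<Rightarrow> ys) n = drop n l"
    for n and l :: "'b list"
    by (induction n) (simp_all add: drop_Suc flip: tl_drop tl_def)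
  ultimately show ?thesis by simp
qed

lemma computable_dec_bool_list: "computable (dec :: nat \<Rightarrow> bool list)"
proof -
  have "computable list_decode"
    by (rule computableI[of "\<lambda>x. x"]) (auto intro: recn_proj simp: enc_list_def map_idI)
  then have "computable (\<lambda>n. map (\<lambda>k. k = (1::nat)) (list_decode n))"
    by (intro computable_intros)
  then show ?thesis unfolding dec_list_def dec_bool_def .
qed

lemma computable_dec_nat_bool_list: "computable (dec :: nat \<Rightarrow> nat \<times> bool list)"
proof -
  have "computable prod_decode"
    by (rule computableI[of "\<lambda>x. x"]) (auto intro: recn_proj simp: enc_prod_def)
  then have "computable (\<lambda>n. (fst (prod_decode n), dec (snd (prod_decode n)) :: bool list))"
    by (intro computable_intros computable_compose[OF computable_dec_bool_list])
  then show ?thesis unfolding dec_prod_def map_prod_def by (simp add: case_prod_beta)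
qed

section \<open>Recursively enumerable sets as projections of decidable sets\<close>

text \<open>Evaluation of a fixed program with every search cut off at \<open>t\<close>. This is total
  computable in \<open>t\<close> and the arguments by recursion on the program alone, so recursively
  enumerable sets are projections of decidable ones without a universal machine.\<close>

fun eval_bounded :: "recf \<Rightarrow> nat \<Rightarrow> nat list \<Rightarrow> nat option" where
  "eval_bounded Zf t xs = Some 0"
| "eval_bounded Sf t xs = (case xs of [] \<Rightarrow> None | y # ys \<Rightarrow> Some (Suc y))"
| "eval_bounded (Idf i) t xs = (case drop i xs of [] \<Rightarrow> None | y # ys \<Rightarrow> Some y)"
| "eval_bounded (Cnf f gs) t xs =
    (case those (map (\<lambda>g. eval_bounded g t xs) gs) of None \<Rightarrow> None | Some ys \<Rightarrow> eval_bounded f t ys)"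
| "eval_bounded (Prf f g) t xs = (case xs of [] \<Rightarrow> None | n # xs \<Rightarrow>
    rec_nat (eval_bounded f t xs)
      (\<lambda>i v. case v of None \<Rightarrow> None | Some y \<Rightarrow> eval_bounded g t (y # i # xs)) n)"
| "eval_bounded (Mnf f) t xs =
    (let m = rec_nat 0 (\<lambda>i m. case eval_bounded f t (i # xs) of None \<Rightarrow> m
                              | Some v \<Rightarrow> if m = i \<and> 0 < v then Suc i else m) t
     in case eval_bounded f t (m # xs) of None \<Rightarrow> None | Some v \<Rightarrow> if v = 0 then Some m else None)"

lemma computable_those_map:
  assumes "\<And>g. g \<in> set gs \<Longrightarrow> computable (h g)"
  shows "computable (\<lambda>p. those (map (\<lambda>g. h g p) gs))"
  using assms
proof (induction gs)
  case (Cons g gs)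
  have "computable (\<lambda>p. case h g p of None \<Rightarrow> None | Some y \<Rightarrow>
      case those (map (\<lambda>g. h g p) gs) of None \<Rightarrow> None | Some ys \<Rightarrow> Some (y # ys))"
    by (intro computable_intros computable_compose[OF Cons.IH] computable_compose[OF Cons.prems]) auto
  moreover have "(case h g p of None \<Rightarrow> None | Some y \<Rightarrow>
      case those (map (\<lambda>g. h g p) gs) of None \<Rightarrow> None | Some ys \<Rightarrow> Some (y # ys))
      = those (map (\<lambda>g. h g p) (g # gs))" for p
    by (simp split: option.split)
  ultimately show ?case by simp
qed (simp add: computable_intros)

lemma computable_eval_bounded: "computable (\<lambda>p. eval_bounded r (fst p) (snd p))"
proof (induction r)
  case (Cnf f gs)
  show ?case
    unfolding eval_bounded.simps
    by (intro computable_intros computable_compose2[OF Cnf(1)] computable_those_map Cnf(2))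
next
  case (Prf f g)
  show ?case
    unfolding eval_bounded.simps
    by (intro computable_intros computable_compose2[OF Prf(1)] computable_compose2[OF Prf(2)])
next
  case (Mnf f)
  show ?case
    unfolding eval_bounded.simps Let_def
    by (intro computable_intros computable_compose2[OF Mnf])
qed (unfold eval_bounded.simps, (intro computable_intros)+)

lemma those_eq_Some: "those xs = Some ys \<longleftrightarrow> xs = map Some ys"
  by (induction xs arbitrary: ys) (auto split: option.split)

text \<open>\<open>c n\<close> is the length of the initial run of positive values among the first
  \<open>n\<close>. The test \<open>m = i\<close> freezes the counter at the first index where the
  value is missing or zero, so what lies beyond has no influence.\<close>

lemma bounded_search:
  fixes w :: "nat \<Rightarrow> nat option"
  defines "c \<equiv> rec_nat 0 (\<lambda>i m. case w i of None \<Rightarrow> m | Some v \<Rightarrow> if m = i \<and> 0 < v then Suc i else m)"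
  shows "c n \<le> n" and "i < c n \<Longrightarrow> \<exists>v. w i = Some (Suc v)"
    and "c n < n \<Longrightarrow> w (c n) \<noteq> Some (Suc v)"
proof -
  have "c n \<le> n \<and> (\<forall>i<c n. \<exists>v. w i = Some (Suc v)) \<and> (c n < n \<longrightarrow> (\<forall>v. w (c n) \<noteq> Some (Suc v)))"
  proof (induction n)
    case 0
    then show ?case by (simp add: c_def)
  next
    case (Suc n)
    have c: "c (Suc n) = (case w n of None \<Rightarrow> c n | Some v \<Rightarrow> if c n = n \<and> 0 < v then Suc n else c n)"
      unfolding c_def by simp
    show ?case
      using Suc
      by (cases "w n"; cases "c n = n") (auto simp: c less_Suc_eq gr0_conv_Suc)
  qed
  then show "c n \<le> n" "i < c n \<Longrightarrow> \<exists>v. w i = Some (Suc v)"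
    "c n < n \<Longrightarrow> w (c n) \<noteq> Some (Suc v)" by auto
qed

lemma eval_bounded_sound: "eval_bounded r t xs = Some y \<Longrightarrow> eval_recf r xs y"
proof (induction r arbitrary: xs y)
  case (Idf i)
  then show ?case
    by (auto split: list.splits)
      (metis drop_eq_Nil2 eval_recf.proj leI list.distinct(1) nth_via_drop)
next
  case (Cnf f gs)
  then obtain ys where ys: "map (\<lambda>g. eval_bounded g t xs) gs = map Some ys" "eval_bounded f t ys = Some y"
    by (auto split: option.splits simp: those_eq_Some)
  have "list_all2 (\<lambda>g y. eval_recf g xs y) gs ys"
    unfolding list_all2_conv_all_nth
  proof (intro conjI allI impI)
    show len: "length gs = length ys" using ys(1) map_eq_imp_length_eq by blast
    fix i assume i: "i < length gs"
    then have "eval_bounded (gs ! i) t xs = Some (ys ! i)"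
      using arg_cong[OF ys(1), of "\<lambda>l. l ! i"] len by simp
    then show "eval_recf (gs ! i) xs (ys ! i)" using Cnf.IH(2) i by simp
  qed
  then show ?case using Cnf.IH(1)[OF ys(2)] by (rule eval_recf.comp)
next
  case (Prf f g)
  then obtain n zs where xs: "xs = n # zs" by (auto split: list.splits)
  have "rec_nat (eval_bounded f t zs)
      (\<lambda>i v. case v of None \<Rightarrow> None | Some y \<Rightarrow> eval_bounded g t (y # i # zs)) n = Some z
      \<Longrightarrow> eval_recf (Prf f g) (n # zs) z" for z
  proof (induction n arbitrary: z)
    case 0
    then show ?case using Prf.IH(1) by (auto intro: eval_recf.pr0)
  next
    case (Suc n)
    then show ?case using Prf.IH(2) by (auto split: option.splits intro: eval_recf.prS)
  qed
  then show ?case using Prf.prems by (simp add: xs)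
next
  case (Mnf f)
  let ?c = "rec_nat 0 (\<lambda>i m. case eval_bounded f t (i # xs) of None \<Rightarrow> m
                              | Some v \<Rightarrow> if m = i \<and> 0 < v then Suc i else m) t"
  have y: "y = ?c" "eval_bounded f t (y # xs) = Some 0"
    using Mnf.prems by (auto simp: Let_def split: option.splits if_splits)
  have "\<exists>v. eval_bounded f t (i # xs) = Some (Suc v)" if "i < y" for i
    using bounded_search(2)[of i "\<lambda>i. eval_bounded f t (i # xs)" t] that y(1) by simp
  then show ?case using y(2) Mnf.IH by (blast intro: eval_recf.mn)
qed (auto split: list.splits intro: eval_recf.intros)

text \<open>The claim concerns all sufficiently large bounds, so no monotonicity of
  \<open>eval_bounded\<close> in the bound has to be proved: the finitely many subcomputations
  settle at various bounds, and eventual statements can be intersected.\<close>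

lemma eval_bounded_complete:
  "eval_recf r xs y \<Longrightarrow> \<forall>\<^sub>F t in sequentially. eval_bounded r t xs = Some y"
proof (induction rule: eval_recf.induct)
  case (proj i xs)
  then show ?case by (simp add: Cons_nth_drop_Suc[symmetric])
next
  case (comp xs gs ys f y)
  have "\<forall>\<^sub>F t in sequentially. \<forall>i\<in>{..<length gs}. eval_bounded (gs ! i) t xs = Some (ys ! i)"
    using comp(1) by (intro eventually_ball_finite) (auto simp: list_all2_conv_all_nth)
  moreover have "\<forall>\<^sub>F t in sequentially. eval_bounded f t ys = Some y"
    by (rule comp)
  ultimately show ?case
  proof eventually_elim
    case (elim t)
    have "map (\<lambda>g. eval_bounded g t xs) gs = map Some ys"
      using elim(1) comp(1) by (auto simp: list_all2_conv_all_nth intro!: nth_equalityI)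
    then show ?case using elim(2) by (simp add: those_eq_Some[THEN iffD2])
  qed
next
  case (pr0 f xs y g)
  then show ?case by simp
next
  case (prS f g n xs y z)
  from prS.IH show ?case by eventually_elim simp
next
  case (mn f n xs)
  have "\<forall>\<^sub>F t in sequentially. \<forall>m\<in>{..<n}. \<exists>k. eval_bounded f t (m # xs) = Some (Suc k)"
    using mn.IH(2) by (intro eventually_ball_finite) (auto elim!: eventually_mono)
  with mn.IH(1) eventually_ge_at_top[of n] show ?case
  proof eventually_elim
    case (elim t)
    let ?w = "\<lambda>i. eval_bounded f t (i # xs)"
    let ?c = "rec_nat 0 (\<lambda>i m. case ?w i of None \<Rightarrow> m
                              | Some v \<Rightarrow> if m = i \<and> 0 < v then Suc i else m) t"
    have "?c = n"
    proof (rule linorder_cases)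
      assume "?c < n"
      then show ?thesis using bounded_search(3)[of ?w t] elim by fastforce
    next
      assume "n < ?c"
      then show ?thesis using bounded_search(2)[of n ?w t] elim by simp
    qed
    then show ?case using elim by (simp add: Let_def)
  qed
qed simp_all

text \<open>Two results of one program must agree at any bound large enough for both, because
  \<open>eval_bounded\<close> is a function.\<close>

lemma eval_recf_deterministic:
  assumes "eval_recf r xs y" "eval_recf r xs z" shows "y = z"
proof -
  have "\<forall>\<^sub>F t in sequentially. eval_bounded r t xs = Some y \<and> eval_bounded r t xs = Some z"
    using assms by (intro eventually_conj eval_bounded_complete)
  then obtain t where "eval_bounded r t xs = Some y \<and> eval_bounded r t xs = Some z"
    using eventually_happens'[OF sequentially_bot] by blast
  then show ?thesis by (metis option.inject)
qed

lemma rec_enumE: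
  assumes "rec_enum A"
  obtains D :: "nat \<Rightarrow> nat \<Rightarrow> bool"
  where "computable (\<lambda>p. D (fst p) (snd p))" "A = {x. \<exists>t. D t x}"
proof -
  obtain r where A: "A = {x. \<exists>y. eval_recf r [x] y}" using assms by (auto simp: rec_enum_def)
  define D where "D t x = (case eval_bounded r t [x] of None \<Rightarrow> False | Some _ \<Rightarrow> True)" for t x
  have "computable (\<lambda>p. D (fst p) (snd p))"
    unfolding D_def by (intro computable_intros computable_compose2[OF computable_eval_bounded])
  moreover have "(\<exists>y. eval_recf r [x] y) \<longleftrightarrow> (\<exists>t. D t x)" for x
  proof
    assume "\<exists>y. eval_recf r [x] y"
    then obtain y where "\<forall>\<^sub>F t in sequentially. eval_bounded r t [x] = Some y"
      using eval_bounded_complete by blast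
    then obtain t where "eval_bounded r t [x] = Some y"
      using eventually_happens'[OF sequentially_bot] by blast
    then show "\<exists>t. D t x" by (auto simp: D_def intro!: exI[of _ t])
  next
    assume "\<exists>t. D t x"
    then show "\<exists>y. eval_recf r [x] y"
      by (auto simp: D_def split: option.splits intro: eval_bounded_sound)
  qed
  ultimately show ?thesis using A that by auto
qed

lemma rec_enumI:
  fixes D :: "nat \<Rightarrow> nat \<Rightarrow> bool"
  assumes "computable (\<lambda>p. D (fst p) (snd p))"
  shows "rec_enum {x. \<exists>t. D t x}"
proof -
  obtain d where d: "\<And>k F. recn k F \<Longrightarrow> recn k (\<lambda>xs. d (F xs))"
    "\<And>p. d (enc p) = enc (D (fst p) (snd p))"
    using assms by (rule computableE) auto
  \<comment> \<open>The characteristic function is reversed because unbounded search stops at a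
    zero: \<open>Mnf\<close> then halts exactly when some witness \<open>t\<close> exists.\<close>
  have "recn 2 (\<lambda>xs. 1 - d (prod_encode (xs ! 0, xs ! 1)))"
    by (intro recn_diff d(1) recn_const recn_prod_encode recn_proj) auto
  then obtain f where f: "\<And>xs. length xs = 2 \<Longrightarrow> eval_recf f xs (1 - d (prod_encode (xs ! 0, xs ! 1)))"
    by (auto simp: recn_def)
  have f': "eval_recf f [t, x] (if D t x then 0 else 1)" for t x
    using f[of "[t, x]"] d(2)[of "(t, x)"] by (auto simp: enc_prod_def enc_bool_def)
  have "(\<exists>y. eval_recf (Mnf f) [x] y) \<longleftrightarrow> (\<exists>t. D t x)" for x
  proof
    assume "\<exists>y. eval_recf (Mnf f) [x] y"
    then obtain y where "eval_recf f [y, x] 0" by (auto elim: eval_recf.cases)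
    with f' have "(if D y x then 0 else 1::nat) = 0" by (rule eval_recf_deterministic)
    then have "D y x" by (simp split: if_splits)
    then show "\<exists>t. D t x" ..
  next
    assume ex: "\<exists>t. D t x"
    let ?n = "LEAST t. D t x"
    have "eval_recf (Mnf f) [x] ?n"
    proof (rule eval_recf.mn)
      show "eval_recf f [?n, x] 0" using f'[of ?n x] LeastI_ex[OF ex] by simp
      show "\<forall>m<?n. \<exists>k. eval_recf f [m, x] (Suc k)"
        using f' not_less_Least[of _ "\<lambda>t. D t x"] by (metis One_nat_def)
    qed
    then show "\<exists>y. eval_recf (Mnf f) [x] y" ..
  qed
  then show ?thesis unfolding rec_enum_def by (intro exI[of _ "Mnf f"]) simp
qed

section \<open>Backward recursion and rational approximation\<close>

lemma code_sit_eq_enc: "code_sit s = enc s"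
  unfolding code_sit_def enc_list_def enc_bool_def by simp

lemma code_ns_eq_enc: "code_ns p = enc p"
  by (simp add: code_ns_def enc_prod_def code_sit_eq_enc)

lemma prod_encode_strict_mono2: "b < c \<Longrightarrow> prod_encode (a, b) < prod_encode (a, c)"
  by (induction c) (auto simp: prod_encode_def less_Suc_eq)

text \<open>The end of \<open>s\<close> is the empty list, of code 0; appending replaces it by a
  positive code, and each \<open>Cons\<close> preserves the increase. This makes backward recursion
  terminate and puts both children later in a table ordered by code.\<close>

lemma enc_less_snoc: "enc s < enc (s @ [x])"
  by (induction s) (auto simp: enc_Cons prod_encode_strict_mono2)

text \<open>Backward recursion over the finite set of situations with code below \<open>N\<close>. Since codes
  increase along a path, the values can be tabulated in order of decreasing code.\<close>

function treerec ::
    "(sit \<Rightarrow> 'v \<Rightarrow> 'v \<Rightarrow> 'v) \<Rightarrow> 'v \<Rightarrow> nat \<Rightarrow> sit \<Rightarrow> 'v" where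
  "treerec h z N s = (if enc s < N
     then h s (treerec h z N (s @ [False])) (treerec h z N (s @ [True])) else z)"
  by auto
termination
  by (relation "measure (\<lambda>(h, z, N, s). N - enc s)")
    (auto intro!: diff_less_mono2 enc_less_snoc)

declare treerec.simps [simp del]

text \<open>\<open>tab x n i\<close> holds the values at the codes from \<open>n - i\<close> up to
  \<open>n - 1\<close>, so the value at code \<open>c\<close> sits at offset
  \<open>c - (n - i)\<close>, and a lookup past the end returns \<open>z\<close>, the value
  prescribed beyond the horizon. Numbers that code no situation also receive a row; its content is
  meaningless, but the rows of situations consult only codes of situations.\<close>

lemma computable_treerec:
  fixes h :: "'a::encodable \<Rightarrow> sit \<Rightarrow> 'v::encodable \<Rightarrow> 'v \<Rightarrow> 'v"
  assumes h: "computable (\<lambda>p. h (fst p) (fst (snd p)) (fst (snd (snd p))) (snd (snd (snd p))))"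
    and N: "computable N" and S: "computable S"
  shows "computable (\<lambda>x. treerec (h x) z (N x) (S x))"
proof -
  have h': "computable (\<lambda>x. h (f1 x) (f2 x) (f3 x) (f4 x))"
    if "computable f1" "computable f2" "computable f3" "computable f4"
    for f1 :: "'c::encodable \<Rightarrow> 'a" and f2 f3 f4
    using computable_compose[OF h, of "\<lambda>x. (f1 x, f2 x, f3 x, f4 x)"] that
    by (simp add: computable_Pair)
  define look where "look L k = (case drop k L of [] \<Rightarrow> z | y # ys \<Rightarrow> y)" for L k
  define tab where "tab x n = rec_nat [] (\<lambda>i L.
      h x (dec (n - Suc i)) (look L (enc ((dec (n - Suc i) :: sit) @ [False]) - (n - i)))
        (look L (enc ((dec (n - Suc i) :: sit) @ [True]) - (n - i))) # L)" for x n
  have "computable (\<lambda>x. look (tab x (N x) (N x)) (enc (S x)))"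
    unfolding tab_def look_def
    by (intro computable_intros h' computable_compose[OF computable_dec_bool_list]
        computable_compose[OF N] computable_compose[OF S])
  moreover have "look (tab x n n) (enc s) = treerec (h x) z n s" for x n s
  proof -
    have "i \<le> n \<Longrightarrow> length (tab x n i) = i \<and>
        (\<forall>s. n - i \<le> enc s \<longrightarrow> look (tab x n i) (enc s - (n - i)) = treerec (h x) z n s)" for i
    proof (induction i)
      case 0
      then show ?case by (simp add: tab_def look_def treerec.simps[of _ _ n])
    next
      case (Suc i)
      let ?L = "tab x n i"
      have IH: "length ?L = i" "\<And>s. n - i \<le> enc s \<Longrightarrow> look ?L (enc s - (n - i)) = treerec (h x) z n s"
        using Suc by auto
      define c where "c = n - Suc i"
      have c: "n - i = Suc c" using Suc.prems by (simp add: c_def)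
      have T: "tab x n (Suc i) = h x (dec c) (look ?L (enc ((dec c :: sit) @ [False]) - Suc c))
        (look ?L (enc ((dec c :: sit) @ [True]) - Suc c)) # ?L"
        by (simp add: tab_def c_def[symmetric] c)
      have "look (tab x n (Suc i)) (enc s - c) = treerec (h x) z n s" if "c \<le> enc s" for s
      proof (cases "enc s = c")
        case True
        then have "dec c = s" by (metis dec_enc)
        moreover have "look ?L (enc (s @ [b]) - Suc c) = treerec (h x) z n (s @ [b])" for b
          using IH(2)[of "s @ [b]"] enc_less_snoc[of s b] True c by simp
        moreover have "enc s < n" using True Suc.prems by (simp add: c_def)
        ultimately show ?thesis
          using True by (subst T) (simp add: look_def treerec.simps[of _ _ n s])
      next
        case False
        then have "enc s - c = Suc (enc s - Suc c)" using that by simp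
        then show ?thesis
          using IH(2)[of s] False that c by (simp add: T look_def)
      qed
      then show ?case using IH(1) T by (simp add: c_def)
    qed
    from this[of n] show ?thesis by simp
  qed
  ultimately show ?thesis by simp
qed

section \<open>Non-negative fractions and monotone approximation by them\<close>

definition fval :: "nat \<times> nat \<Rightarrow> real" where
  "fval p = real (fst p) / real (snd p)"

definition frac_add :: "nat \<times> nat \<Rightarrow> nat \<times> nat \<Rightarrow> nat \<times> nat" where
  "frac_add p q = (fst p * snd q + fst q * snd p, snd p * snd q)"

definition frac_mult :: "nat \<times> nat \<Rightarrow> nat \<times> nat \<Rightarrow> nat \<times> nat" where
  "frac_mult p q = (fst p * fst q, snd p * snd q)"

definition frac_max :: "nat \<times> nat \<Rightarrow> nat \<times> nat \<Rightarrow> nat \<times> nat" where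
  "frac_max p q = (if fst p * snd q \<le> fst q * snd p then q else p)"

lemma fval_Pair [simp]: "fval (m, n) = real m / real n"
  by (simp add: fval_def)

lemma fval_nonneg: "0 \<le> fval p"
  by (simp add: fval_def)

lemma fval_add: "0 < snd p \<Longrightarrow> 0 < snd q \<Longrightarrow> fval (frac_add p q) = fval p + fval q"
  by (simp add: fval_def frac_add_def field_simps)

lemma fval_mult: "fval (frac_mult p q) = fval p * fval q"
  by (simp add: fval_def frac_mult_def)

lemma fval_le_iff: "0 < snd p \<Longrightarrow> 0 < snd q \<Longrightarrow> fval p \<le> fval q \<longleftrightarrow> fst p * snd q \<le> fst q * snd p"
  by (simp add: fval_def divide_simps flip: of_nat_mult)

lemma fval_max: "0 < snd p \<Longrightarrow> 0 < snd q \<Longrightarrow> fval (frac_max p q) = max (fval p) (fval q)"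
  by (simp add: max_def fval_le_iff) (simp add: frac_max_def)

lemma computable_frac_ops [computable_intros]:
  assumes "computable f" "computable g"
  shows "computable (\<lambda>x. frac_add (f x) (g x))" "computable (\<lambda>x. frac_mult (f x) (g x))"
    "computable (\<lambda>x. frac_max (f x) (g x))"
  unfolding frac_add_def frac_mult_def frac_max_def by (intro computable_intros assms)+

lemma computable_div2_even [computable_intros]:
  fixes f :: "'a::encodable \<Rightarrow> nat"
  assumes "computable f"
  shows "computable (\<lambda>x. f x div 2)" "computable (\<lambda>x. even (f x))"
proof -
  have "computable (\<lambda>x. rec_nat (0::nat, True)
      (\<lambda>_ p. if snd p then (fst p, False) else (Suc (fst p), True)) (f x))"
    by (intro computable_intros assms)
  moreover have "rec_nat (0::nat, True)
      (\<lambda>_ p. if snd p then (fst p, False) else (Suc (fst p), True)) n = (n div 2, even n)" for n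
    by (induction n) auto
  ultimately have "computable (\<lambda>x. (f x div 2, even (f x)))" by simp
  from computable_fst[OF this] computable_snd[OF this]
  show "computable (\<lambda>x. f x div 2)" "computable (\<lambda>x. even (f x))" by simp_all
qed

text \<open>The shift \<open>k\<close> serves to approximate \<open>1 - p\<close> from below: for a
  computable \<open>p\<close> the map \<open>- p\<close> is lower semicomputable, and
  \<open>k = 1\<close> brings it into the non-negative range. Truncation at 0 is monotone and
  continuous, so it disturbs neither the order of the approximations nor the limit, and it lets
  pairs of naturals replace signed rationals.\<close>

lemma lower_semicomputable_fracE:
  fixes k :: nat
  assumes "lower_semicomputable r"
  obtains c where "computable (\<lambda>p. c (fst p) (snd p))" "\<And>s n. 0 < snd (c s n)"
    "\<And>s. incseq (\<lambda>n. fval (c s n))" "\<And>s. (\<lambda>n. fval (c s n)) \<longlonglongrightarrow> max 0 (real k + r s)"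
proof -
  obtain q where q: "recursive_rat_map q" "\<And>s n. q s n \<le> q s (Suc n)"
    "\<And>s. (\<lambda>n. real_of_rat (q s n)) \<longlonglongrightarrow> r s"
    using assms by (auto simp: lower_semicomputable_def)
  obtain a b where ab: "recursive_fun a" "recursive_fun b" "\<And>s n. q s n =
      of_int (int_decode (a (enc (s, n)))) / of_nat (b (enc (s, n)))"
    using q(1) by (auto simp: recursive_rat_map_def enc_prod_def code_sit_eq_enc)
  have a: "computable (\<lambda>p. a (enc (p :: sit \<times> nat)))" and b: "computable (\<lambda>p. b (enc (p :: sit \<times> nat)))"
    unfolding computable_def using ab(1,2) by auto
  \<comment> \<open>An even code \<open>A\<close> stands for \<open>A div 2\<close> and an odd one
    for \<open>- (A div 2) - 1\<close>; truncated subtraction on naturals performs the cut at 0. A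
    zero denominator makes the rational 0, hence the value \<open>k\<close>.\<close>
  define c where "c s n = (let A = a (enc (s, n)); B = b (enc (s, n)) in
      if B = 0 then (k, 1)
      else (if even A then A div 2 + k * B else k * B - Suc (A div 2), B))" for s :: sit and n :: nat
  have "computable (\<lambda>p. c (fst p) (snd p))"
    unfolding c_def Let_def prod.collapse
    by (intro computable_intros a b)
  moreover have "0 < snd (c s n)" for s n
    by (simp add: c_def Let_def)
  moreover have val: "fval (c s n) = max 0 (real k + real_of_rat (q s n))" for s n
  proof -
    define A B where "A = a (enc (s, n))" and "B = b (enc (s, n))"
    have q: "real_of_rat (q s n) = real_of_int (int_decode A) / real B"
      by (simp add: ab A_def B_def of_rat_divide)
    show ?thesis
    proof (cases "B = 0")
      case True
      then show ?thesis by (simp add: q) (simp add: c_def fval_def flip: A_def B_def)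
    next
      case False
      have "real k + real_of_int (int_decode A) / real B = (real k * real B + real_of_int (int_decode A)) / real B"
        using False by (simp add: field_simps)
      also have "max 0 \<dots> = max 0 (real k * real B + real_of_int (int_decode A)) / real B"
        using False by (auto simp: max_def divide_simps)
      also have "max 0 (real k * real B + real_of_int (int_decode A)) = real (fst (c s n))"
        using False
        by (auto simp: c_def int_decode_def sum_decode_def max_def of_nat_diff simp flip: A_def B_def of_nat_mult)
      finally show ?thesis using False q by (simp add: fval_def c_def Let_def B_def)
    qed
  qed
  moreover have "incseq (\<lambda>n. fval (c s n))" for s
    using q(2)[of s] by (intro incseq_SucI) (auto simp: val max_def of_rat_less_eq intro: order_trans)
  moreover have "(\<lambda>n. fval (c s n)) \<longlonglongrightarrow> max 0 (real k + r s)" for s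
    unfolding val by (intro tendsto_intros q)
  ultimately show ?thesis using that by blast
qed

lemma lower_semicomputable_fracI:
  assumes c: "computable (\<lambda>p. c (fst p) (snd p))"
    and inc: "\<And>s. incseq (\<lambda>n. fval (c s n))" and lim: "\<And>s. (\<lambda>n. fval (c s n)) \<longlonglongrightarrow> r s"
  shows "lower_semicomputable r"
proof -
  define q :: "sit \<Rightarrow> nat \<Rightarrow> rat" where "q s n = of_nat (fst (c s n)) / of_nat (snd (c s n))" for s n
  have q: "real_of_rat (q s n) = fval (c s n)" for s n
    by (simp add: q_def fval_def of_rat_divide)
  have "computable (\<lambda>p. 2 * fst (c (fst p) (snd p)))" "computable (\<lambda>p. snd (c (fst p) (snd p)))"
    by (intro computable_intros c)+
  then obtain a b where "recursive_fun a" "\<And>p. a (enc p) = 2 * fst (c (fst p) (snd p))"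
    "recursive_fun b" "\<And>p. b (enc p) = snd (c (fst p) (snd p))"
    unfolding computable_def by auto
  moreover have "prod_encode (code_sit s, n) = enc (s, n)" for s n
    by (simp add: code_sit_eq_enc enc_prod_def)
  ultimately have "recursive_rat_map q"
    unfolding recursive_rat_map_def q_def
    by (intro exI[of _ a] exI[of _ b]) (simp add: int_decode_def sum_decode_def)
  moreover have "q s n \<le> q s (Suc n)" for s n
    using incseq_SucD[OF inc[of s], of n] by (simp add: of_rat_less_eq flip: q)
  ultimately show ?thesis
    unfolding lower_semicomputable_def using lim q by auto
qed

section \<open>Supermartingales and Ville's inequality\<close>

text \<open>The expectation is affine in \<open>p\<close>, so its maximum over an interval is at an
  endpoint. Each supermartingale condition thereby becomes two linear inequalities.\<close>

lemma upper_exp_le_iff: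
  assumes "a \<le> b"
  shows "upper_exp {a..b} f \<le> c \<longleftrightarrow>
    a * f True + (1 - a) * f False \<le> c \<and> b * f True + (1 - b) * f False \<le> c"
proof -
  let ?g = "\<lambda>p. p * f True + (1 - p) * f False"
  have le: "?g p \<le> max (?g a) (?g b)" if "p \<in> {a..b}" for p
  proof (cases "f False \<le> f True")
    case True
    then have "(b - p) * (f True - f False) \<ge> 0" using that by (intro mult_nonneg_nonneg) auto
    then show ?thesis by (simp add: algebra_simps)
  next
    case False
    then have "(p - a) * (f False - f True) \<ge> 0" using that by (intro mult_nonneg_nonneg) auto
    then show ?thesis by (simp add: algebra_simps)
  qed
  have bdd: "bdd_above (?g ` {a..b})"
    using le by (intro bdd_aboveI2)
  have "upper_exp {a..b} f \<le> c \<longleftrightarrow> (\<forall>p\<in>{a..b}. ?g p \<le> c)"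
    unfolding upper_exp_def using assms bdd by (subst cSup_le_iff) auto
  also have "\<dots> \<longleftrightarrow> ?g a \<le> c \<and> ?g b \<le> c"
  proof (intro iffI ballI)
    fix p assume "?g a \<le> c \<and> ?g b \<le> c" and p: "p \<in> {a..b}"
    then have "max (?g a) (?g b) \<le> c" by simp
    with le[OF p] show "?g p \<le> c" by (rule order_trans)
  qed (use assms in auto)
  finally show ?thesis .
qed

lemma forecasting_systemD:
  assumes "forecasting_system \<phi>"
  shows "\<phi> s = {lower_fc \<phi> s..upper_fc \<phi> s}" "0 \<le> lower_fc \<phi> s"
    "lower_fc \<phi> s \<le> upper_fc \<phi> s" "upper_fc \<phi> s \<le> 1"
proof -
  obtain a b where "\<phi> s = {a..b}" "0 \<le> a" "a \<le> b" "b \<le> 1"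
    using assms unfolding forecasting_system_def intervals_def by blast
  then show "\<phi> s = {lower_fc \<phi> s..upper_fc \<phi> s}" "0 \<le> lower_fc \<phi> s"
    "lower_fc \<phi> s \<le> upper_fc \<phi> s" "upper_fc \<phi> s \<le> 1"
    by (simp_all add: lower_fc_def upper_fc_def)
qed

lemma supermartingale_iff:
  assumes "forecasting_system \<phi>"
  shows "supermartingale \<phi> M \<longleftrightarrow> (\<forall>s.
    lower_fc \<phi> s * M (s @ [True]) + (1 - lower_fc \<phi> s) * M (s @ [False]) \<le> M s \<and>
    upper_fc \<phi> s * M (s @ [True]) + (1 - upper_fc \<phi> s) * M (s @ [False]) \<le> M s)"
proof -
  have "upper_exp (\<phi> s) f \<le> c \<longleftrightarrow>
      lower_fc \<phi> s * f True + (1 - lower_fc \<phi> s) * f False \<le> c \<and>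
      upper_fc \<phi> s * f True + (1 - upper_fc \<phi> s) * f False \<le> c" for s f c
    using upper_exp_le_iff[OF forecasting_systemD(3)[OF assms]]
    by (subst forecasting_systemD(1)[OF assms])
  then show ?thesis unfolding supermartingale_def by simp
qed

lemma length_prefix [simp]: "length (prefix \<omega> n) = n"
  by (simp add: prefix_def)

lemma prefix_Suc: "prefix \<omega> (Suc n) = prefix \<omega> n @ [\<omega> n]"
  by (simp add: prefix_def)

lemma take_prefix: "k \<le> n \<Longrightarrow> take k (prefix \<omega> n) = prefix \<omega> k"
  by (simp add: prefix_def take_map)

lemma mem_cylset_iff: "\<omega> \<in> cylset A \<longleftrightarrow> (\<exists>k. prefix \<omega> k \<in> A)"
proof
  assume "\<omega> \<in> cylset A"
  then obtain s where "s \<in> A" "prefix \<omega> (length s) = s" by (auto simp: cylset_def cyl_def)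
  then show "\<exists>k. prefix \<omega> k \<in> A" by metis
next
  assume "\<exists>k. prefix \<omega> k \<in> A"
  then obtain k where "prefix \<omega> k \<in> A" ..
  then show "\<omega> \<in> cylset A"
    unfolding cylset_def cyl_def by (intro UN_I[of "prefix \<omega> k"]) auto
qed

text \<open>Ville's inequality: the witness is \<open>T / 2 ^ n\<close> stopped, at value 1, when \<open>T\<close>
  first exceeds \<open>2 ^ n\<close>.\<close>

lemma upper_prob_exceeds_le:
  assumes fs: "forecasting_system \<phi>" and T: "test_supermartingale \<phi> T"
  shows "upper_prob \<phi> (cylset {s. 2 ^ n < T s}) \<le> ereal ((1/2) ^ n)"
proof -
  define hit where "hit s \<longleftrightarrow> (\<exists>k\<le>length s. 2 ^ n < T (take k s))" for s
  define M where "M s = (if hit s then 1 else T s / 2 ^ n)" for s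
  have nonneg: "0 \<le> T s" and T1: "T [] = 1" for s
    using T by (auto simp: test_supermartingale_def)
  have sup: "lower_fc \<phi> s * T (s @ [True]) + (1 - lower_fc \<phi> s) * T (s @ [False]) \<le> T s"
    "upper_fc \<phi> s * T (s @ [True]) + (1 - upper_fc \<phi> s) * T (s @ [False]) \<le> T s" for s
    using T by (auto simp: test_supermartingale_def supermartingale_iff[OF fs])
  have hit_snoc: "hit (s @ [x]) \<longleftrightarrow> hit s \<or> 2 ^ n < T (s @ [x])" for s x
  proof
    assume "hit (s @ [x])"
    then obtain k where k: "k \<le> Suc (length s)" "2 ^ n < T (take k (s @ [x]))"
      by (auto simp: hit_def)
    show "hit s \<or> 2 ^ n < T (s @ [x])"
      using k by (cases "k = Suc (length s)") (auto simp: hit_def le_Suc_eq)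
  next
    assume "hit s \<or> 2 ^ n < T (s @ [x])"
    then show "hit (s @ [x])"
    proof
      assume "hit s"
      then obtain k where "k \<le> length s" "2 ^ n < T (take k s)" by (auto simp: hit_def)
      then show ?thesis unfolding hit_def by (intro exI[of _ k]) auto
    next
      assume "2 ^ n < T (s @ [x])"
      then show ?thesis unfolding hit_def by (intro exI[of _ "Suc (length s)"]) auto
    qed
  qed
  \<comment> \<open>A child that stops here has \<open>T / 2 ^ n\<close> above 1; a child that does
    not stop keeps exactly \<open>T / 2 ^ n\<close>.\<close>
  have M_le: "M (s @ [x]) \<le> T (s @ [x]) / 2 ^ n" if "\<not> hit s" for s x
    using that by (auto simp: M_def hit_snoc)
  have "p * M (s @ [True]) + (1 - p) * M (s @ [False]) \<le> M s"
    if p: "0 \<le> p" "p \<le> 1" "p * T (s @ [True]) + (1 - p) * T (s @ [False]) \<le> T s" for p s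
  proof (cases "hit s")
    case True
    then show ?thesis by (simp add: M_def hit_snoc)
  next
    case False
    have "p * M (s @ [True]) + (1 - p) * M (s @ [False])
        \<le> p * (T (s @ [True]) / 2 ^ n) + (1 - p) * (T (s @ [False]) / 2 ^ n)"
      using p M_le[OF False] by (intro add_mono mult_left_mono) auto
    also have "\<dots> = (p * T (s @ [True]) + (1 - p) * T (s @ [False])) / 2 ^ n"
      by (simp add: field_simps)
    also have "\<dots> \<le> M s"
      using p(3) False by (simp add: M_def divide_right_mono)
    finally show ?thesis .
  qed
  then have "supermartingale \<phi> M"
    unfolding supermartingale_iff[OF fs]
    using sup forecasting_systemD[OF fs] order_trans[OF forecasting_systemD(2,3)[OF fs]]
      order_trans[OF forecasting_systemD(3,4)[OF fs]] by blast
  moreover have "(if \<omega> \<in> cylset {s. 2 ^ n < T s} then 1 else 0)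
      \<le> liminf (\<lambda>m. ereal (M (prefix \<omega> m)))" for \<omega>
  proof (cases "\<omega> \<in> cylset {s. 2 ^ n < T s}")
    case True
    then obtain k where k: "2 ^ n < T (prefix \<omega> k)" by (auto simp: mem_cylset_iff)
    have "\<forall>\<^sub>F m in sequentially. 1 \<le> ereal (M (prefix \<omega> m))"
      using eventually_ge_at_top[of k]
    proof eventually_elim
      case (elim m)
      then have "hit (prefix \<omega> m)" using k by (auto simp: hit_def take_prefix)
      then show ?case by (simp add: M_def)
    qed
    then show ?thesis using True by (simp add: Liminf_bounded)
  next
    case False
    have "\<forall>\<^sub>F m in sequentially. 0 \<le> ereal (M (prefix \<omega> m))"
      using nonneg by (auto simp: M_def)
    then show ?thesis using False by (simp add: Liminf_bounded)
  qed
  moreover have "M [] = (1/2) ^ n"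
    by (simp add: M_def hit_def T1 power_one_over not_less)
  ultimately show ?thesis
    unfolding upper_prob_def by (intro Inf_lower CollectI exI[of _ M]) simp
qed

lemma rec_enum_exceeds:
  assumes "lower_semicomputable T" and nonneg: "\<And>s. 0 \<le> T s"
  shows "rec_enum (code_ns ` {(n, s). 2 ^ n < T s})"
proof -
  obtain c where c: "computable (\<lambda>p. c (fst p) (snd p))" "\<And>s n. 0 < snd (c s n)"
    "\<And>s. incseq (\<lambda>n. fval (c s n))" "\<And>s. (\<lambda>n. fval (c s n)) \<longlonglongrightarrow> max 0 (real 0 + T s)"
    by (rule lower_semicomputable_fracE[OF assms(1), where k = 0]) blast
  have lim: "(\<lambda>n. fval (c s n)) \<longlonglongrightarrow> T s" for s
    using c(4)[of s] nonneg[of s] by simp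
  have ex: "2 ^ n < T s \<longleftrightarrow> (\<exists>t. 2 ^ n * snd (c s t) < fst (c s t))" for n s
  proof -
    have "2 ^ n < T s \<longleftrightarrow> (\<exists>t. 2 ^ n < fval (c s t))"
    proof
      assume "2 ^ n < T s"
      then have "\<forall>\<^sub>F t in sequentially. 2 ^ n < fval (c s t)" by (rule order_tendstoD(1)[OF lim])
      then show "\<exists>t. 2 ^ n < fval (c s t)" by (rule eventually_happens'[OF sequentially_bot])
    next
      assume "\<exists>t. 2 ^ n < fval (c s t)"
      then obtain t where "2 ^ n < fval (c s t)" ..
      also have "fval (c s t) \<le> T s" by (rule incseq_le[OF c(3) lim])
      finally show "2 ^ n < T s" .
    qed
    also have "\<dots> \<longleftrightarrow> (\<exists>t. real (2 ^ n * snd (c s t)) < real (fst (c s t)))"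
      using c(2)[of s] by (simp add: fval_def pos_less_divide_eq)
    finally show ?thesis by (simp only: of_nat_less_iff)
  qed
  \<comment> \<open>The first conjunct rejects numbers that code no pair, since \<open>dec\<close>
    maps those to some pair as well.\<close>
  define D where "D t x \<longleftrightarrow> enc (dec x :: nat \<times> sit) = x \<and>
      2 ^ fst (dec x :: nat \<times> sit) * snd (c (snd (dec x :: nat \<times> sit)) t)
        < fst (c (snd (dec x :: nat \<times> sit)) t)" for t x
  have "computable (\<lambda>p. D (fst p) (snd p))"
    unfolding D_def
    by (intro computable_intros computable_compose[OF computable_dec_nat_bool_list]
        computable_compose2[OF c(1)])
  then have "rec_enum {x. \<exists>t. D t x}" by (rule rec_enumI)
  moreover have "{x. \<exists>t. D t x} = code_ns ` {(n, s). 2 ^ n < T s}"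
  proof (intro set_eqI iffI)
    fix x assume "x \<in> {x. \<exists>t. D t x}"
    then obtain t where t: "D t x" by blast
    obtain n s where ns: "(dec x :: nat \<times> sit) = (n, s)" by (rule prod.exhaust)
    from t have "code_ns (n, s) = x" "2 ^ n < T s"
      unfolding D_def ns ex code_ns_eq_enc fst_conv snd_conv by blast+
    then show "x \<in> code_ns ` {(n, s). 2 ^ n < T s}" by blast
  next
    fix x assume "x \<in> code_ns ` {(n, s). 2 ^ n < T s}"
    then obtain n s where x: "x = enc (n, s)" and "2 ^ n < T s" by (auto simp: code_ns_eq_enc)
    then obtain t where "2 ^ n * snd (c s t) < fst (c s t)" using ex by blast
    then have "D t x" unfolding D_def x by simp
    then show "x \<in> {x. \<exists>t. D t x}" by blast
  qed
  ultimately show ?thesis by simp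
qed

theorem ml_random_if_test_random:
  assumes fs: "forecasting_system \<phi>" and \<omega>: "ml_test_random \<phi> \<omega>"
  shows "ml_random \<phi> \<omega>"
  unfolding ml_random_def
proof (intro allI impI)
  fix T assume T: "lower_semicomputable T \<and> test_supermartingale \<phi> T"
  define A where "A = {(n, s). 2 ^ n < T s}"
  have A: "section_at A n = {s. 2 ^ n < T s}" for n
    by (simp add: section_at_def A_def)
  have "0 \<le> T s" for s using T by (simp add: test_supermartingale_def)
  then have "ml_test \<phi> A"
    unfolding ml_test_def A using T rec_enum_exceeds upper_prob_exceeds_le[OF fs]
    by (simp add: A_def)
  with \<omega> obtain n where "\<omega> \<notin> cylset {s. 2 ^ n < T s}"
    by (auto simp: ml_test_random_def A)
  then show "bdd_above (range (\<lambda>n. T (prefix \<omega> n)))"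
    by (intro bdd_aboveI[of _ "2 ^ n"]) (auto simp: mem_cylset_iff not_less)
qed

text \<open>Some child never exceeds its parent, since otherwise the expectation at the lower
  endpoint would exceed the parent too. Following such children from \<open>s\<close> gives a path
  that turns a statement about limits inferior into one about the single value
  \<open>M s\<close>.\<close>

lemma supermartingale_descending_path:
  assumes fs: "forecasting_system \<phi>" and M: "supermartingale \<phi> M"
  obtains \<omega> where "\<omega> \<in> cyl s" "\<And>n. length s \<le> n \<Longrightarrow> M (prefix \<omega> n) \<le> M s"
proof -
  have "\<exists>x. M (t @ [x]) \<le> M t" for t
  proof (rule ccontr)
    assume "\<not> (\<exists>x. M (t @ [x]) \<le> M t)"
    then have *: "M t < M (t @ [True])" "M t < M (t @ [False])" by (auto simp: not_le)
    let ?p = "lower_fc \<phi> t"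
    have p: "0 \<le> ?p" "?p \<le> 1" using forecasting_systemD[OF fs, of t] by auto
    have "?p * M t + (1 - ?p) * M t < ?p * M (t @ [True]) + (1 - ?p) * M (t @ [False])"
    proof (cases "?p = 0")
      case False
      then show ?thesis using * p by (intro add_less_le_mono mult_strict_left_mono mult_left_mono) auto
    qed (use * in auto)
    moreover have "?p * M (t @ [True]) + (1 - ?p) * M (t @ [False]) \<le> M t"
      using M supermartingale_iff[OF fs] by blast
    ultimately show False by (simp add: algebra_simps)
  qed
  then obtain x where x: "\<And>t. M (t @ [x t]) \<le> M t" by metis
  define t where "t = rec_nat s (\<lambda>_ r. r @ [x r])"
  define \<omega> where "\<omega> i = (if i < length s then s ! i else x (t (i - length s)))" for i
  have p0: "prefix \<omega> (length s) = s"
    by (auto simp: prefix_def \<omega>_def intro!: nth_equalityI)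
  have pt: "prefix \<omega> (length s + n) = t n" for n
  proof (induction n)
    case (Suc n)
    have "\<omega> (length s + n) = x (t n)" by (simp add: \<omega>_def)
    then show ?case using Suc by (simp add: prefix_Suc t_def)
  qed (simp add: p0 t_def)
  have Mt: "M (t n) \<le> M s" for n
    by (induction n) (auto simp: t_def intro: order_trans[OF x])
  show thesis
  proof (rule that)
    show "\<omega> \<in> cyl s" by (simp add: cyl_def p0)
    show "M (prefix \<omega> n) \<le> M s" if "length s \<le> n" for n
      using pt[of "n - length s"] Mt that by simp
  qed
qed

text \<open>\<open>upper_prob\<close> does not ask its supermartingales to be non-negative. Both
  bounds are recovered from the limit condition along a descending path through \<open>s\<close>, on
  which \<open>M s\<close> bounds the limit inferior from above.\<close>

lemma dominating_supermartingale_ge: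
  assumes fs: "forecasting_system \<phi>" and M: "supermartingale \<phi> M"
    and dom: "\<forall>\<omega>. (if \<omega> \<in> G then 1 else 0) \<le> liminf (\<lambda>n. ereal (M (prefix \<omega> n)))"
  shows "0 \<le> M s" and "cyl s \<subseteq> G \<Longrightarrow> 1 \<le> M s"
proof -
  obtain \<omega> where \<omega>: "\<omega> \<in> cyl s" "\<And>n. length s \<le> n \<Longrightarrow> M (prefix \<omega> n) \<le> M s"
    using supermartingale_descending_path[OF fs M] by metis
  have "liminf (\<lambda>n. ereal (M (prefix \<omega> n))) \<le> liminf (\<lambda>n. ereal (M s))"
    by (intro Liminf_mono eventually_mono[OF eventually_ge_at_top[of "length s"]]) (simp add: \<omega>)
  then have "liminf (\<lambda>n. ereal (M (prefix \<omega> n))) \<le> ereal (M s)"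
    by (simp add: Liminf_const)
  with dom[rule_format] have le: "(if \<omega> \<in> G then 1 else 0) \<le> ereal (M s)"
    by (rule order_trans)
  have "(0::ereal) \<le> (if \<omega> \<in> G then 1 else 0)" by simp
  from order_trans[OF this le] show "0 \<le> M s" by simp
  show "1 \<le> M s" if "cyl s \<subseteq> G" using le \<omega>(1) that by (auto split: if_splits)
qed

text \<open>\<open>C\<close> depends on \<open>s\<close> but not on \<open>M\<close>. The
  construction yields the product, over the steps leading to \<open>s\<close>, of
  \<open>1 / p\<close> with \<open>p\<close> the largest probability that the forecast allows for
  the outcome taken. Non-degeneracy makes each \<open>p\<close> positive, and non-negativity of
  \<open>M\<close> allows the other child to be dropped.\<close>

lemma supermartingale_growth:
  assumes fs: "forecasting_system \<phi>" and nd: "non_degenerate \<phi>"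
  obtains C where "0 < C"
    "\<And>M. supermartingale \<phi> M \<Longrightarrow> (\<And>s. 0 \<le> M s) \<Longrightarrow> M s \<le> C * M []"
proof -
  have "\<exists>C>0. \<forall>M. supermartingale \<phi> M \<longrightarrow> (\<forall>s. 0 \<le> M s) \<longrightarrow> M s \<le> C * M []"
  proof (induction s rule: rev_induct)
    case Nil
    show ?case by (intro exI[of _ 1]) auto
  next
    case (snoc x s)
    then obtain C where C: "0 < C"
      "\<And>M. supermartingale \<phi> M \<Longrightarrow> (\<forall>s. 0 \<le> M s) \<Longrightarrow> M s \<le> C * M []" by blast
    define p where "p = (if x then upper_fc \<phi> s else 1 - lower_fc \<phi> s)"
    have p: "0 < p" using nd by (simp add: p_def non_degenerate_def)
    have "M (s @ [x]) \<le> (C / p) * M []" if M: "supermartingale \<phi> M" "\<forall>s. 0 \<le> M s" for M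
    proof -
      have "p * M (s @ [x]) \<le> M s"
      proof (cases x)
        case True
        have "upper_fc \<phi> s * M (s @ [True]) + (1 - upper_fc \<phi> s) * M (s @ [False]) \<le> M s"
          using M(1) supermartingale_iff[OF fs] by blast
        moreover have "0 \<le> (1 - upper_fc \<phi> s) * M (s @ [False])"
          using M(2) forecasting_systemD[OF fs, of s] by simp
        ultimately show ?thesis using True by (simp add: p_def)
      next
        case False
        have "lower_fc \<phi> s * M (s @ [True]) + (1 - lower_fc \<phi> s) * M (s @ [False]) \<le> M s"
          using M(1) supermartingale_iff[OF fs] by blast
        moreover have "0 \<le> lower_fc \<phi> s * M (s @ [True])"
          using M(2) forecasting_systemD[OF fs, of s] by simp
        ultimately show ?thesis using False by (simp add: p_def)
      qed
      also have "M s \<le> C * M []" using C M by simp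
      finally show ?thesis using p by (simp add: field_simps)
    qed
    then show ?case using C(1) p by (intro exI[of _ "C / p"]) auto
  qed
  then show ?thesis using that by blast
qed

section \<open>The supermartingale of a Martin-Loef test\<close>

text \<open>The analytic argument is kept apart from the coding: sections grow with a stage, and
  four real sequences increase to the weights of the two children at both endpoints.
  \<open>p\<close> and \<open>1 - p\<close> need separate sequences, since \<open>1 - a s l\<close>
  would approach its limit from above.\<close>

locale approximated_test =
  fixes \<phi> :: "sit \<Rightarrow> real set" and D :: "nat \<Rightarrow> nat \<Rightarrow> sit \<Rightarrow> bool"
    and a a' b b' :: "sit \<Rightarrow> nat \<Rightarrow> real"
  assumes fs: "forecasting_system \<phi>" and nd: "non_degenerate \<phi>"
    and D_mono: "l \<le> m \<Longrightarrow> D l n s \<Longrightarrow> D m n s"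
    and test: "upper_prob \<phi> (cylset {s. \<exists>l. D l n s}) \<le> ereal ((1/2) ^ n)"
    and nonneg: "0 \<le> a s l" "0 \<le> a' s l" "0 \<le> b s l" "0 \<le> b' s l"
    and inc: "incseq (a s)" "incseq (a' s)" "incseq (b s)" "incseq (b' s)"
    and lim: "a s \<longlonglongrightarrow> lower_fc \<phi> s" "a' s \<longlonglongrightarrow> 1 - lower_fc \<phi> s"
      "b s \<longlonglongrightarrow> upper_fc \<phi> s" "b' s \<longlonglongrightarrow> 1 - upper_fc \<phi> s"
begin

text \<open>\<open>U l n s\<close> approximates from below the upper probability, conditional on \<open>s\<close>, of ever
  visiting the \<open>n\<close>-th section of the test.\<close>

definition U_step :: "nat \<Rightarrow> nat \<Rightarrow> sit \<Rightarrow> real \<Rightarrow> real \<Rightarrow> real" where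
  "U_step l n s v0 v1 = (if D l n s then 1
     else max (a s l * v1 + a' s l * v0) (b s l * v1 + b' s l * v0))"

definition U :: "nat \<Rightarrow> nat \<Rightarrow> sit \<Rightarrow> real" where
  "U l n = treerec (U_step l n) 0 l"

lemma U_rec: "U l n s = (if enc s < l then U_step l n s (U l n (s @ [False])) (U l n (s @ [True])) else 0)"
  unfolding U_def by (subst treerec.simps) simp

lemmas approx_le = incseq_le[OF inc(1) lim(1)] incseq_le[OF inc(2) lim(2)]
  incseq_le[OF inc(3) lim(3)] incseq_le[OF inc(4) lim(4)]

lemma U_induct:
  assumes "\<And>s. (\<And>x. enc s < l \<Longrightarrow> P (s @ [x])) \<Longrightarrow> P s"
  shows "P s"
proof (induction "l - enc s" arbitrary: s rule: less_induct)
  case less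
  show ?case
    by (rule assms, rule less) (simp add: diff_less_mono2 enc_less_snoc)
qed

lemma weights_le:
  assumes "0 \<le> v0" "v0 \<le> 1" "0 \<le> v1" "v1 \<le> 1"
  shows "a s l * v1 + a' s l * v0 \<le> 1" "b s l * v1 + b' s l * v0 \<le> 1"
proof -
  have "a s l * v1 + a' s l * v0 \<le> lower_fc \<phi> s * 1 + (1 - lower_fc \<phi> s) * 1"
    using assms approx_le[of s l] forecasting_systemD[OF fs, of s]
    by (intro add_mono mult_mono) auto
  then show "a s l * v1 + a' s l * v0 \<le> 1" by simp
  have "b s l * v1 + b' s l * v0 \<le> upper_fc \<phi> s * 1 + (1 - upper_fc \<phi> s) * 1"
    using assms approx_le[of s l] forecasting_systemD[OF fs, of s]
    by (intro add_mono mult_mono) auto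
  then show "b s l * v1 + b' s l * v0 \<le> 1" by simp
qed

lemma U_bounds: "0 \<le> U l n s \<and> U l n s \<le> 1"
proof (induction s rule: U_induct[where l = l])
  case (1 s)
  show ?case
  proof (cases "enc s < l")
    case True
    have "0 \<le> a s l * U l n (s @ [True]) + a' s l * U l n (s @ [False])"
      using 1 True nonneg by simp
    moreover have "a s l * U l n (s @ [True]) + a' s l * U l n (s @ [False]) \<le> 1"
      "b s l * U l n (s @ [True]) + b' s l * U l n (s @ [False]) \<le> 1"
      using 1 True weights_le by simp_all
    ultimately show ?thesis
      using True by (subst (1 2) U_rec) (auto simp: U_step_def le_max_iff_disj)
  qed (simp add: U_rec[of l n s])
qed

text \<open>Raising the index extends the horizon, enlarges the section and increases the weights
  all at once. No value or weight is negative, so each change can only raise the result, and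
  entering the section sets the maximal value 1.\<close>

lemma U_mono:
  assumes "l \<le> m" shows "U l n s \<le> U m n s"
proof (induction s rule: U_induct[where l = l])
  case (1 s)
  show ?case
  proof (cases "enc s < l \<and> \<not> D m n s")
    case True
    have *: "x l * U l n (s @ [c]) \<le> x m * U m n (s @ [c])"
      if "incseq x" "\<And>l. 0 \<le> x l" for x c
      using 1 True U_bounds that incseqD[OF that(1) assms] by (intro mult_mono) auto
    have "\<not> D l n s" using True D_mono[OF assms] by blast
    then have "U l n s = max (a s l * U l n (s @ [True]) + a' s l * U l n (s @ [False]))
        (b s l * U l n (s @ [True]) + b' s l * U l n (s @ [False]))"
      using True by (simp add: U_rec[of l n s] U_step_def)
    also have "\<dots> \<le> max (a s m * U m n (s @ [True]) + a' s m * U m n (s @ [False]))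
        (b s m * U m n (s @ [True]) + b' s m * U m n (s @ [False]))"
      by (intro max.mono add_mono * inc nonneg)
    also have "\<dots> = U m n s"
      using True assms by (simp add: U_rec[of m n s] U_step_def)
    finally show ?thesis .
  next
    case False
    show ?thesis
    proof (cases "enc s < l")
      case True
      with False assms have "U m n s = 1" by (simp add: U_rec[of m n s] U_step_def)
      then show ?thesis using U_bounds by simp
    next
      case False
      then have "U l n s = 0" by (simp add: U_rec[of l n s])
      then show ?thesis using U_bounds by simp
    qed
  qed
qed

text \<open>Beyond the horizon 0 lies below the non-negative \<open>M\<close>; inside the section
  the whole cylinder forces \<open>M\<close> to be at least 1; elsewhere the weights of
  \<open>U\<close> lie below the true ones, for which \<open>M\<close> obeys the supermartingale
  inequality.\<close>

lemma U_le_dominating: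
  assumes M: "supermartingale \<phi> M"
    and dom: "\<forall>\<omega>. (if \<omega> \<in> cylset {s. \<exists>l. D l n s} then 1 else 0) \<le> liminf (\<lambda>n. ereal (M (prefix \<omega> n)))"
  shows "U l n s \<le> M s"
proof (induction s rule: U_induct[where l = l])
  case (1 s)
  note ge = dominating_supermartingale_ge[OF fs M dom]
  consider "\<not> enc s < l" | "enc s < l" "D l n s" | "enc s < l" "\<not> D l n s" by blast
  then show ?case
  proof cases
    case 1
    then show ?thesis using ge(1) by (simp add: U_rec[of l n s])
  next
    case 2
    then have "cyl s \<subseteq> cylset {s. \<exists>l. D l n s}" by (auto simp: cylset_def)
    then show ?thesis using 2 ge(2) by (simp add: U_rec[of l n s] U_step_def)
  next
    case 3
    have "a s l * U l n (s @ [True]) + a' s l * U l n (s @ [False])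
        \<le> lower_fc \<phi> s * M (s @ [True]) + (1 - lower_fc \<phi> s) * M (s @ [False])"
      using 1 3 U_bounds approx_le[of s l] forecasting_systemD[OF fs, of s]
      by (intro add_mono mult_mono) auto
    also have "\<dots> \<le> M s" using M supermartingale_iff[OF fs] by blast
    finally have A: "a s l * U l n (s @ [True]) + a' s l * U l n (s @ [False]) \<le> M s" .
    have "b s l * U l n (s @ [True]) + b' s l * U l n (s @ [False])
        \<le> upper_fc \<phi> s * M (s @ [True]) + (1 - upper_fc \<phi> s) * M (s @ [False])"
      using 1 3 U_bounds approx_le[of s l] forecasting_systemD[OF fs, of s]
      by (intro add_mono mult_mono) auto
    also have "\<dots> \<le> M s" using M supermartingale_iff[OF fs] by blast
    finally show ?thesis using 3 A by (simp add: U_rec[of l n s] U_step_def)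
  qed
qed

text \<open>This carries bounds over to the infimum: \<open>x / C\<close> lies below the initial
  value of each dominating \<open>M\<close>, hence below the upper probability. The constant is 1 at
  the root and the growth constant elsewhere.\<close>

lemma le_if_le_dominating:
  assumes "0 < C"
    and le: "\<And>M. supermartingale \<phi> M \<Longrightarrow> (\<And>s. 0 \<le> M s) \<Longrightarrow> (\<And>l s. U l n s \<le> M s) \<Longrightarrow> x \<le> C * M []"
  shows "x \<le> C * (1/2) ^ n"
proof -
  have "ereal (x / C) \<le> upper_prob \<phi> (cylset {s. \<exists>l. D l n s})"
    unfolding upper_prob_def
  proof (rule Inf_greatest, clarify)
    fix M assume M: "supermartingale \<phi> M" "\<forall>\<omega>. (if \<omega> \<in> cylset {s. \<exists>l. D l n s} then 1 else 0)
      \<le> liminf (\<lambda>n. ereal (M (prefix \<omega> n)))"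
    have "x \<le> C * M []"
      using M dominating_supermartingale_ge(1)[OF fs M] U_le_dominating[OF M] by (intro le)
    then show "ereal (x / C) \<le> ereal (M [])" using assms(1) by (simp add: field_simps)
  qed
  also note test
  finally show ?thesis using assms(1) by (simp add: field_simps)
qed

lemma U_Nil_le: "U l n [] \<le> (1/2) ^ n"
  using le_if_le_dominating[of 1 n "U l n []"] by simp

text \<open>The growth constant of \<open>s\<close> carries the decay at the root over to
  \<open>s\<close>. That \<open>C\<close> is the same for all \<open>n\<close> is what bounds the
  weighted sum.\<close>

lemma U_le: "\<exists>C>0. \<forall>l n. U l n s \<le> C * (1/2) ^ n"
proof -
  obtain C where C: "0 < C" "\<And>M. supermartingale \<phi> M \<Longrightarrow> (\<And>s. 0 \<le> M s) \<Longrightarrow> M s \<le> C * M []"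
    using supermartingale_growth[OF fs nd, of s] by metis
  have "U l n s \<le> C * (1/2) ^ n" for l n
    by (rule le_if_le_dominating[OF C(1)], rule order_trans[OF _ C(2)])
  then show ?thesis using C(1) by blast
qed

text \<open>The weights \<open>2 ^ n\<close> make the mixture large as soon as a single section of
  high index is visited.\<close>

definition Q :: "sit \<Rightarrow> nat \<Rightarrow> real" where
  "Q s l = (\<Sum>n<l. 2 ^ n / 2 * U l (2 * n) s)"

lemma Q_nonneg: "0 \<le> Q s l"
  unfolding Q_def using U_bounds by (intro sum_nonneg) simp

lemma Q_incseq: "incseq (Q s)"
proof (rule incseq_SucI)
  fix l
  have "Q s l \<le> (\<Sum>n<l. 2 ^ n / 2 * U (Suc l) (2 * n) s)"
    unfolding Q_def by (intro sum_mono mult_left_mono U_mono) auto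
  also have "\<dots> \<le> Q s (Suc l)"
    unfolding Q_def using U_bounds by simp
  finally show "Q s l \<le> Q s (Suc l)" .
qed

text \<open>The weight \<open>2 ^ n / 2\<close> against \<open>(1/2) ^ (2 * n)\<close> leaves
  \<open>(1/2) ^ n / 2\<close>, and these terms sum to at most 1. The factor 1/2 in the weights is
  there to get 1 rather than 2 at the root.\<close>

lemma Q_le:
  assumes "0 \<le> C" "\<And>l n. U l n s \<le> C * (1/2) ^ n"
  shows "Q s l \<le> C"
proof -
  have "Q s l \<le> (\<Sum>n<l. 2 ^ n / 2 * (C * (1/2) ^ (2 * n)))"
    unfolding Q_def by (intro sum_mono mult_left_mono assms) auto
  also have "\<dots> = (\<Sum>n<l. C / 2 * (1/2) ^ n)"
    by (intro sum.cong) (auto simp: power_mult power2_eq_square power_mult_distrib[symmetric] power_divide field_simps)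
  also have "\<dots> = C / 2 * (\<Sum>n<l. (1/2) ^ n)" by (simp add: sum_distrib_left)
  also have "(\<Sum>n<l. (1/2::real) ^ n) = 2 - 2 * (1/2) ^ l"
    by (induction l) auto
  also have "C / 2 * (2 - 2 * (1/2) ^ l) \<le> C"
    using assms(1) by (simp add: algebra_simps)
  finally show ?thesis .
qed

definition T0 :: "sit \<Rightarrow> real" where "T0 s = (SUP l. Q s l)"

lemma Q_tendsto: "Q s \<longlonglongrightarrow> T0 s"
proof -
  obtain C where "C > 0" "\<And>l n. U l n s \<le> C * (1/2) ^ n" using U_le by blast
  then have "bdd_above (range (Q s))" by (intro bdd_aboveI2[of _ _ C] Q_le) auto
  then show ?thesis unfolding T0_def using Q_incseq by (intro LIMSEQ_incseq_SUP)
qed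

lemma Q_le_T0: "Q s l \<le> T0 s"
  using incseq_le[OF Q_incseq Q_tendsto] .

lemma T0_nonneg: "0 \<le> T0 s"
  using Q_nonneg Q_le_T0 order_trans by blast

lemma T0_Nil_le: "T0 [] \<le> 1"
  using Q_tendsto by (rule LIMSEQ_le_const2) (use Q_le[of 1] U_Nil_le in auto)

text \<open>At a stage whose horizon lies beyond \<open>s\<close>, the mixture obeys the inequality
  with the approximate weights, because it is linear in the values of \<open>U\<close>. In the
  limit, weights and values reach their exact counterparts together.\<close>

lemma T0_supermartingale:
  "lower_fc \<phi> s * T0 (s @ [True]) + (1 - lower_fc \<phi> s) * T0 (s @ [False]) \<le> T0 s"
  "upper_fc \<phi> s * T0 (s @ [True]) + (1 - upper_fc \<phi> s) * T0 (s @ [False]) \<le> T0 s"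
proof -
  \<comment> \<open>Inside the section the right-hand side is 1, and the weights sum to at most
    1.\<close>
  have U: "a s l * U l n (s @ [True]) + a' s l * U l n (s @ [False]) \<le> U l n s"
    "b s l * U l n (s @ [True]) + b' s l * U l n (s @ [False]) \<le> U l n s" if "enc s < l" for l n
    using that weights_le U_bounds
    by (auto simp: U_rec[of l n s] U_step_def)
  have Q: "x * Q (s @ [True]) l + y * Q (s @ [False]) l \<le> Q s l"
    if "\<And>n. x * U l n (s @ [True]) + y * U l n (s @ [False]) \<le> U l n s" for x y l
  proof -
    have "x * Q (s @ [True]) l + y * Q (s @ [False]) l
        = (\<Sum>n<l. 2 ^ n / 2 * (x * U l (2 * n) (s @ [True]) + y * U l (2 * n) (s @ [False])))"
      by (simp add: Q_def sum_distrib_left sum.distrib[symmetric] algebra_simps)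
    also have "\<dots> \<le> Q s l"
      unfolding Q_def by (intro sum_mono mult_left_mono that) auto
    finally show ?thesis .
  qed
  have "a s l * Q (s @ [True]) l + a' s l * Q (s @ [False]) l \<le> T0 s"
    "b s l * Q (s @ [True]) l + b' s l * Q (s @ [False]) l \<le> T0 s" if "enc s < l" for l
    using Q[OF U(1)[OF that]] Q[OF U(2)[OF that]] Q_le_T0 by (auto intro: order_trans)
  then show "lower_fc \<phi> s * T0 (s @ [True]) + (1 - lower_fc \<phi> s) * T0 (s @ [False]) \<le> T0 s"
    "upper_fc \<phi> s * T0 (s @ [True]) + (1 - upper_fc \<phi> s) * T0 (s @ [False]) \<le> T0 s"
    by (auto intro!: LIMSEQ_le_const2[OF tendsto_add[OF tendsto_mult[OF lim(1) Q_tendsto]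
          tendsto_mult[OF lim(2) Q_tendsto]]]
        LIMSEQ_le_const2[OF tendsto_add[OF tendsto_mult[OF lim(3) Q_tendsto]
          tendsto_mult[OF lim(4) Q_tendsto]]] exI[of _ "Suc (enc s)"])
qed

text \<open>\<open>T0 []\<close> may be below 1, even 0, so dividing by it is not an option. Raising
  the root value is harmless: the root is no child, so its value occurs only on the larger side of a
  supermartingale inequality.\<close>

definition T :: "sit \<Rightarrow> real" where "T s = (if s = [] then 1 else T0 s)"

lemma T0_le_T: "T0 s \<le> T s"
  using T0_Nil_le by (simp add: T_def)

lemma test_supermartingale_T: "test_supermartingale \<phi> T"
  unfolding test_supermartingale_def supermartingale_iff[OF fs]
  using order_trans[OF T0_supermartingale(1) T0_le_T] order_trans[OF T0_supermartingale(2) T0_le_T]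
  by (auto simp: T_def T0_nonneg)

lemma T_unbounded:
  assumes "\<And>n. \<omega> \<in> cylset {s. \<exists>l. D l n s}"
  shows "\<not> bdd_above (range (\<lambda>k. T (prefix \<omega> k)))"
proof
  assume "bdd_above (range (\<lambda>k. T (prefix \<omega> k)))"
  then obtain B where B: "\<And>k. T (prefix \<omega> k) \<le> B" by (auto simp: bdd_above_def)
  obtain n where n: "2 * B < 2 ^ n" using real_arch_pow[of 2 "2 * B"] by auto
  obtain k l where kl: "D l (2 * n) (prefix \<omega> k)"
    using assms[of "2 * n"] by (auto simp: mem_cylset_iff)
  \<comment> \<open>By stage \<open>?m\<close> the situation has been enumerated, the term with
    index \<open>n\<close> belongs to the sum, and the situation lies below the horizon; the last
    two require strict inequalities, hence \<open>Suc\<close>.\<close>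
  let ?s = "prefix \<omega> k" and ?m = "Suc (max l (max n (enc (prefix \<omega> k))))"
  have "D ?m (2 * n) ?s" using kl by (rule D_mono[rotated]) simp
  then have "U ?m (2 * n) ?s = 1" by (simp add: U_rec[of ?m] U_step_def)
  then have "2 ^ n / 2 = 2 ^ n / 2 * U ?m (2 * n) ?s" by simp
  also have "\<dots> \<le> Q ?s ?m"
    unfolding Q_def using U_bounds by (intro member_le_sum) auto
  also have "\<dots> \<le> T ?s" using Q_le_T0 T0_le_T order_trans by blast
  also have "\<dots> \<le> B" by (rule B)
  finally show False using n by simp
qed

end

theorem test_random_if_ml_random:
  assumes fs: "forecasting_system \<phi>" and nd: "non_degenerate \<phi>" and comp: "computable_fs \<phi>"
    and \<omega>: "ml_random \<phi> \<omega>"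
  shows "ml_test_random \<phi> \<omega>"
  unfolding ml_test_random_def
proof (intro allI impI notI)
  fix A assume A: "ml_test \<phi> A" and mem: "\<omega> \<in> (\<Inter>n. cylset (section_at A n))"
  have "rec_enum (code_ns ` A)" using A by (simp add: ml_test_def)
  then obtain E :: "nat \<Rightarrow> nat \<Rightarrow> bool"
    where E: "computable (\<lambda>p. E (fst p) (snd p))" "code_ns ` A = {x. \<exists>t. E t x}"
    by (rule rec_enumE) blast
  \<comment> \<open>\<open>E\<close> is not known to be monotone in its bound; collecting all
    earlier bounds makes \<open>D\<close> increase with \<open>l\<close>.\<close>
  define D where "D l n s \<longleftrightarrow> (\<exists>t<l. E t (enc (n, s)))" for l n :: nat and s :: sit
  have "(\<exists>l. D l n s) \<longleftrightarrow> enc (n, s) \<in> code_ns ` A" for n s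
    unfolding E(2) D_def by blast
  also have "enc (n, s) \<in> code_ns ` A \<longleftrightarrow> (n, s) \<in> A" for n s
    unfolding image_iff code_ns_eq_enc enc_eq_iff by blast
  finally have D: "{s. \<exists>l. D l n s} = section_at A n" for n
    by (simp add: section_at_def)
  have lsc: "lower_semicomputable (lower_fc \<phi>)" "lower_semicomputable (\<lambda>s. - lower_fc \<phi> s)"
    "lower_semicomputable (upper_fc \<phi>)" "lower_semicomputable (\<lambda>s. - upper_fc \<phi> s)"
    using comp by (auto simp: computable_fs_def computable_real_map_def upper_semicomputable_def)
  obtain a where a: "computable (\<lambda>p. a (fst p) (snd p))" "\<And>s n. 0 < snd (a s n)"
    "\<And>s. incseq (\<lambda>n. fval (a s n))" "\<And>s. (\<lambda>n. fval (a s n)) \<longlonglongrightarrow> max 0 (real 0 + lower_fc \<phi> s)"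
    by (rule lower_semicomputable_fracE[OF lsc(1), where k = 0]) blast
  obtain a' where a': "computable (\<lambda>p. a' (fst p) (snd p))" "\<And>s n. 0 < snd (a' s n)"
    "\<And>s. incseq (\<lambda>n. fval (a' s n))" "\<And>s. (\<lambda>n. fval (a' s n)) \<longlonglongrightarrow> max 0 (real 1 + - lower_fc \<phi> s)"
    by (rule lower_semicomputable_fracE[OF lsc(2), where k = 1]) blast
  obtain b where b: "computable (\<lambda>p. b (fst p) (snd p))" "\<And>s n. 0 < snd (b s n)"
    "\<And>s. incseq (\<lambda>n. fval (b s n))" "\<And>s. (\<lambda>n. fval (b s n)) \<longlonglongrightarrow> max 0 (real 0 + upper_fc \<phi> s)"
    by (rule lower_semicomputable_fracE[OF lsc(3), where k = 0]) blast
  obtain b' where b': "computable (\<lambda>p. b' (fst p) (snd p))" "\<And>s n. 0 < snd (b' s n)"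
    "\<And>s. incseq (\<lambda>n. fval (b' s n))" "\<And>s. (\<lambda>n. fval (b' s n)) \<longlonglongrightarrow> max 0 (real 1 + - upper_fc \<phi> s)"
    by (rule lower_semicomputable_fracE[OF lsc(4), where k = 1]) blast
  interpret approximated_test \<phi> D "\<lambda>s l. fval (a s l)" "\<lambda>s l. fval (a' s l)"
    "\<lambda>s l. fval (b s l)" "\<lambda>s l. fval (b' s l)"
  proof
    show "D l n s \<Longrightarrow> D m n s" if "l \<le> m" for l m n s
      using that by (auto simp: D_def intro: order_less_le_trans)
    show "upper_prob \<phi> (cylset {s. \<exists>l. D l n s}) \<le> ereal ((1/2) ^ n)" for n
      using A by (simp add: D ml_test_def)
    have p: "0 \<le> lower_fc \<phi> s" "lower_fc \<phi> s \<le> 1" "0 \<le> upper_fc \<phi> s" "upper_fc \<phi> s \<le> 1" for s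
      using forecasting_systemD[OF fs, of s] by auto
    show "(\<lambda>l. fval (a s l)) \<longlonglongrightarrow> lower_fc \<phi> s" "(\<lambda>l. fval (a' s l)) \<longlonglongrightarrow> 1 - lower_fc \<phi> s"
      "(\<lambda>l. fval (b s l)) \<longlonglongrightarrow> upper_fc \<phi> s" "(\<lambda>l. fval (b' s l)) \<longlonglongrightarrow> 1 - upper_fc \<phi> s" for s
      using a(4)[of s] a'(4)[of s] b(4)[of s] b'(4)[of s] p[of s] by (simp_all add: max_def)
  qed (use fs nd a(3) a'(3) b(3) b'(3) fval_nonneg in auto)
  \<comment> \<open>\<open>h\<close>, \<open>V\<close> and \<open>W\<close> repeat
    \<open>U_step\<close>, \<open>U\<close> and the root-corrected \<open>Q\<close> on fractions, so
    that computability can be read off. Positive denominators are carried along because sums and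
    maxima of fractions rely on them.\<close>
  define h where "h l n s v0 v1 = (if D l n s then (1, 1)
      else frac_max (frac_add (frac_mult (a s l) v1) (frac_mult (a' s l) v0))
        (frac_add (frac_mult (b s l) v1) (frac_mult (b' s l) v0)))" for l n s v0 v1
  define V where "V l n = treerec (h l n) (0, 1) l" for l n
  have V_rec: "V l n s = (if enc s < l then h l n s (V l n (s @ [False])) (V l n (s @ [True]))
      else (0, 1))" for l n s
    unfolding V_def by (subst treerec.simps) simp
  have V: "0 < snd (V l n s) \<and> fval (V l n s) = U l n s" for l n s
  proof (induction s rule: U_induct[where l = l])
    case (1 s)
    have pos: "0 < snd (frac_mult p q)" "0 < snd (frac_add p q)" "0 < snd (frac_max p q)"
      if "0 < snd p" "0 < snd q" for p q
      using that by (auto simp: frac_mult_def frac_add_def frac_max_def)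
    show ?case
    proof (cases "enc s < l")
      case True
      then show ?thesis
        using 1[OF True] a(2) a'(2) b(2) b'(2) pos
        by (simp add: V_rec[of l n s] U_rec[of l n s] U_step_def h_def fval_max fval_add fval_mult)
    next
      case False
      then show ?thesis by (simp add: V_rec[of l n s] U_rec[of l n s])
    qed
  qed
  define W where "W s l = (case s of [] \<Rightarrow> (1, 1) | y # ys \<Rightarrow>
      rec_nat (0, 1) (\<lambda>n v. frac_add v (frac_mult (2 ^ n, 2) (V l (2 * n) s))) l)" for s l
  have W: "fval (W s l) = (if s = [] then 1 else Q s l)" for s l
  proof (cases s)
    case Nil
    then show ?thesis by (simp add: W_def)
  next
    case (Cons y ys)
    have "0 < snd (rec_nat (0, 1) (\<lambda>n v. frac_add v (frac_mult (2 ^ n, 2) (V l (2 * n) s))) m) \<and>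
      fval (rec_nat (0, 1) (\<lambda>n v. frac_add v (frac_mult (2 ^ n, 2) (V l (2 * n) s))) m)
        = (\<Sum>n<m. 2 ^ n / 2 * U l (2 * n) s)" for m
    proof (induction m)
      case (Suc m)
      have "0 < snd (frac_mult (2 ^ m, 2) (V l (2 * m) s))"
        using V[of l "2 * m" s] by (simp add: frac_mult_def)
      then show ?case
        using Suc V[of l "2 * m" s]
        by (simp add: fval_add fval_mult) (simp add: frac_add_def)
    qed simp
    then show ?thesis using Cons by (simp add: W_def Q_def)
  qed
  have "computable (\<lambda>p. W (fst p) (snd p))"
    unfolding W_def V_def h_def D_def
    by (intro computable_intros computable_treerec computable_compose2[OF E(1)]
        computable_compose2[OF a(1)] computable_compose2[OF a'(1)]
        computable_compose2[OF b(1)] computable_compose2[OF b'(1)])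
  moreover have "incseq (\<lambda>l. fval (W s l))" for s
    using Q_incseq[of s] by (auto simp: W incseq_def)
  moreover have "(\<lambda>l. fval (W s l)) \<longlonglongrightarrow> T s" for s
    using Q_tendsto[of s] by (simp add: W T_def)
  ultimately have "lower_semicomputable T" by (rule lower_semicomputable_fracI)
  then have "bdd_above (range (\<lambda>n. T (prefix \<omega> n)))"
    using test_supermartingale_T by (intro \<omega>[unfolded ml_random_def, rule_format, of T] conjI)
  moreover have "\<omega> \<in> cylset {s. \<exists>l. D l n s}" for n
    using mem by (simp add: D)
  ultimately show False using T_unbounded by blast
qed

theorem theorem6p9:
  fixes \<phi> :: "sit \<Rightarrow> real set" and \<omega> :: path
  assumes "forecasting_system \<phi>" and "non_degenerate \<phi>" and "computable_fs \<phi>"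
  shows "ml_random \<phi> \<omega> \<longleftrightarrow> ml_test_random \<phi> \<omega>"
  using assms ml_random_if_test_random test_random_if_ml_random by blast

end
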